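(* Let $P$ be a finite geometric lattice, fix a total order on its atoms, and let $S=\{s_1<\dots<s_k\}$ be a set of nontrivial ranks of $P$, with $m=\max S=s_k$ and $S'=S\setminus\{m\}$. For each $u\in P$ of rank $m$, consider the geometric lattice $[\hat0,u]$ (whose atoms are the atoms of $P$ below $u$, with the induced order) and the set of elements $\bar f_{chain}(v_F)$, where $F$ ranges over the standard fillings of $\mathrm{Rib}(s_1,s_2-s_1,\dots,s_k-s_{k-1})$ whose reading word is an $\mathrm{NBC}^+$ basis of $[\hat0,u]$, and $\bar f_{chain}$ is taken with respect to the rank set $S'$ in $[\hat0,u]$. Then the union over all $u$ of rank $m$ of these sets is a basis of the rank-selected Whitney homology $W\!H_S(P)$.
   Context: $W\!H_S(P):=\bigoplus_{u:\ \mathrm{rk}(u)=\max S}\tilde H_{|S|-2}\big(\Delta((\hat0,u)^{S'});\mathbb C\big)$, where $(\hat0,u)^{S'}$ is the set of $y$ with $\hat0<y<u$ and rank in $S'$ (if $S'=\emptyset$ the order complex is empty, with reduced homology $\mathbb C$ in degree $-1$). A geometric lattice is a finite atomic semimodular lattice; $A(x)$ is the set of atoms below $x$. An NBC independent set is a set $\{a_1,\dots,a_l\}$ of atoms whose join has rank $l$ and such that every atom not in the set lying below its join comes later in the atom order than at least one element of the set. An $\mathrm{NBC}^+$ basis of a geometric lattice $L$ of rank $r$ is an ordered NBC independent set $(a_1,\dots,a_r)$ with $a_j=\min(A(a_1\vee\dots\vee a_j)\setminus A(a_1\vee\dots\vee a_{j-1}))$ for each $j$. $\mathrm{Rib}(r_1,\dots,r_p)$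 is the ribbon (connected skew shape with no $2\times2$ square) with rows of lengths $r_1,\dots,r_p$ from bottom to top, each row starting directly above the last box of the row below. Reading word: entries read left to right, bottom row to top. Standard: entries increase in atom order left to right in rows and top to bottom in columns. Tabloid $\{F\}$: $F$ modulo permuting entries within rows; $v_F=\sum_{\sigma\in\mathrm{Col}_F}\mathrm{sgn}(\sigma)\{\sigma F\}$ with $\mathrm{Col}_F$ the permutations of entries preserving columns. For a filling of $\mathrm{Rib}(s_1,\dots,s_k-s_{k-1})$ with reading word $(F_1,\dots,F_m)$ forming a basis of $[\hat0,u]$, $\bar f_{chain}(\{F\})$ is the chain $F_1\vee\dots\vee F_{s_1}<\dots<F_1\vee\dots\vee F_{s_{k-1}}$ in $(\hat0,u)^{S'}$, an oriented simplex; extended linearly. *)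

theory Defs
  imports Complex_Main "HOL-Library.Finite_Lattice" "HOL-Combinatorics.Permutations"
begin

definition covers :: "'a::order \<Rightarrow> 'a \<Rightarrow> bool" where
  "covers x y \<longleftrightarrow> x < y \<and> \<not> (\<exists>z. x < z \<and> z < y)"

definition is_atom :: "'a::finite_lattice_complete \<Rightarrow> bool" where
  "is_atom a \<longleftrightarrow> covers bot a"

definition atoms_below :: "'a::finite_lattice_complete \<Rightarrow> 'a set" where
  "atoms_below x = {a. is_atom a \<and> a \<le> x}"

definition rk :: "'a::finite_lattice_complete \<Rightarrow> nat" where
  "rk x = Max {length ys | ys. sorted_wrt (<) ys \<and> (\<forall>y\<in>set ys. bot < y \<and> y \<le> x)}"

definition geometric_lattice :: "'a::finite_lattice_complete itself \<Rightarrow> bool" where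
  "geometric_lattice _ \<longleftrightarrow>
     (\<forall>x::'a. x = Sup (atoms_below x)) \<and>
     (\<forall>a b::'a. covers (inf a b) a \<longrightarrow> covers b (sup a b))"

section \<open>NBC and NBC+ bases (atom order given by an injective weight w)\<close>

definition atom_min :: "('a \<Rightarrow> nat) \<Rightarrow> 'a set \<Rightarrow> 'a" where
  "atom_min w X = (THE a. a \<in> X \<and> (\<forall>b\<in>X. w a \<le> w b))"

definition nbc_independent :: "('a::finite_lattice_complete \<Rightarrow> nat) \<Rightarrow> 'a set \<Rightarrow> bool" where
  "nbc_independent w I \<longleftrightarrow> I \<subseteq> {a. is_atom a} \<and> rk (Sup I) = card I \<and>
     (\<forall>b. is_atom b \<and> b \<notin> I \<and> b \<le> Sup I \<longrightarrow> (\<exists>a\<in>I. w a < w b))"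

text \<open>NBC+ basis of the interval lattice [0,u]: its atoms are the atoms of P below u
  (with the induced order), its joins are those of P, and its rank is rk u.\<close>
definition nbc_plus_basis :: "('a::finite_lattice_complete \<Rightarrow> nat) \<Rightarrow> 'a \<Rightarrow> 'a list \<Rightarrow> bool" where
  "nbc_plus_basis w u as \<longleftrightarrow>
     set as \<subseteq> atoms_below u \<and> distinct as \<and> length as = rk u \<and>
     nbc_independent w (set as) \<and>
     (\<forall>j<length as. as ! j =
        atom_min w (atoms_below (Sup (set (take (Suc j) as))) - atoms_below (Sup (set (take j as)))))"

text \<open>Cells are (column, row); rows are numbered 0,1,... from bottom to top.
  Row j has length rs!j and starts directly above the last box of row j-1.\<close>
fun rstart :: "nat list \<Rightarrow> nat \<Rightarrow> nat" where
  "rstart rs 0 = 0"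
| "rstart rs (Suc j) = rstart rs j + rs ! j - 1"

definition rib :: "nat list \<Rightarrow> (nat \<times> nat) set" where
  "rib rs = {(c, r). r < length rs \<and> rstart rs r \<le> c \<and> c < rstart rs r + rs ! r}"

definition reading_word :: "nat list \<Rightarrow> (nat \<times> nat \<Rightarrow> 'a) \<Rightarrow> 'a list" where
  "reading_word rs F = concat (map (\<lambda>r. map (\<lambda>c. F (c, r)) [rstart rs r..<rstart rs r + rs ! r]) [0..<length rs])"

definition standard_filling :: "('a \<Rightarrow> nat) \<Rightarrow> nat list \<Rightarrow> (nat \<times> nat \<Rightarrow> 'a) \<Rightarrow> bool" where
  "standard_filling w rs F \<longleftrightarrow>
     (\<forall>c c' r. (c, r) \<in> rib rs \<and> (c', r) \<in> rib rs \<and> c < c' \<longrightarrow> w (F (c, r)) < w (F (c', r))) \<and>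
     (\<forall>c r r'. (c, r) \<in> rib rs \<and> (c, r') \<in> rib rs \<and> r < r' \<longrightarrow> w (F (c, r')) < w (F (c, r)))"

text \<open>A tabloid is represented by the sets of entries in each row.\<close>
type_synonym 'a tabloid = "nat \<Rightarrow> 'a set"

definition tabloid :: "nat list \<Rightarrow> (nat \<times> nat \<Rightarrow> 'a) \<Rightarrow> 'a tabloid" where
  "tabloid rs F = (\<lambda>r. if r < length rs then F ` {x \<in> rib rs. snd x = r} else {})"

definition col_perms :: "nat list \<Rightarrow> ((nat \<times> nat) \<Rightarrow> (nat \<times> nat)) set" where
  "col_perms rs = {\<pi>. \<pi> permutes rib rs \<and> (\<forall>x. fst (\<pi> x) = fst x)}"

text \<open>v_F, an element of the free complex vector space on tabloids.\<close>
definition v_F :: "nat list \<Rightarrow> (nat \<times> nat \<Rightarrow> 'a) \<Rightarrow> 'a tabloid \<Rightarrow> complex" where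
  "v_F rs F = (\<lambda>T. \<Sum>\<pi>\<in>col_perms rs. if tabloid rs (F \<circ> \<pi>) = T then of_int (sign \<pi>) else 0)"

text \<open>Oriented simplices with k vertices of the order complex of Q: strictly increasing lists.
  k = 0 gives the empty simplex (reduced homology in degree -1). Degree d = k - 1.\<close>
definition simplices :: "'a::order set \<Rightarrow> nat \<Rightarrow> 'a list set" where
  "simplices Q k = {xs. length xs = k \<and> sorted_wrt (<) xs \<and> set xs \<subseteq> Q}"

definition chain_on :: "'a::order set \<Rightarrow> nat \<Rightarrow> ('a list \<Rightarrow> complex) \<Rightarrow> bool" where
  "chain_on Q k c \<longleftrightarrow> (\<forall>xs. c xs \<noteq> 0 \<longrightarrow> xs \<in> simplices Q k)"

definition boundary :: "'a::order set \<Rightarrow> nat \<Rightarrow> ('a list \<Rightarrow> complex) \<Rightarrow> ('a list \<Rightarrow> complex)" where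
  "boundary Q k c = (\<lambda>ys. \<Sum>xs\<in>simplices Q k. c xs *
       (\<Sum>i<k. if take i xs @ drop (Suc i) xs = ys then (-1) ^ i else 0))"

text \<open>Reduced cycles and boundaries in degree k-1 (k vertices).\<close>
definition cycles :: "'a::order set \<Rightarrow> nat \<Rightarrow> ('a list \<Rightarrow> complex) set" where
  "cycles Q k = {c. chain_on Q k c \<and> boundary Q k c = (\<lambda>_. 0)}"

definition boundaries :: "'a::order set \<Rightarrow> nat \<Rightarrow> ('a list \<Rightarrow> complex) set" where
  "boundaries Q k = boundary Q (Suc k) ` {c. chain_on Q (Suc k) c}"

definition rank_sel_open :: "nat set \<Rightarrow> 'a::finite_lattice_complete \<Rightarrow> 'a set" where
  "rank_sel_open S' u = {y. bot < y \<and> y < u \<and> rk y \<in> S'}"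

text \<open>WH_S(P) = direct sum over u of rank max S of the reduced homology in degree |S|-2,
  i.e. with |S|-1 vertices. Elements of the direct sum of chain groups are families
  indexed by u (zero outside rank max S).\<close>
definition WH_cycles :: "nat set \<Rightarrow> ('a::finite_lattice_complete \<Rightarrow> 'a list \<Rightarrow> complex) set" where
  "WH_cycles S = {C. \<forall>u. (rk u = Max S \<longrightarrow> C u \<in> cycles (rank_sel_open (S - {Max S}) u) (card S - 1))
                      \<and> (rk u \<noteq> Max S \<longrightarrow> C u = (\<lambda>_. 0))}"

definition WH_boundaries :: "nat set \<Rightarrow> ('a::finite_lattice_complete \<Rightarrow> 'a list \<Rightarrow> complex) set" where
  "WH_boundaries S = {C. \<forall>u. (rk u = Max S \<longrightarrow> C u \<in> boundaries (rank_sel_open (S - {Max S}) u) (card S - 1))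
                      \<and> (rk u \<noteq> Max S \<longrightarrow> C u = (\<lambda>_. 0))}"

definition homology_basis :: "('i \<Rightarrow> 'j \<Rightarrow> complex) set \<Rightarrow> ('i \<Rightarrow> 'j \<Rightarrow> complex) set
                              \<Rightarrow> ('i \<Rightarrow> 'j \<Rightarrow> complex) set \<Rightarrow> bool" where
  "homology_basis Z Bd B \<longleftrightarrow> B \<subseteq> Z \<and>
     (\<forall>z\<in>Z. \<exists>T g. finite T \<and> T \<subseteq> B \<and> (\<lambda>u x. z u x - (\<Sum>b\<in>T. g b * b u x)) \<in> Bd) \<and>
     (\<forall>T g. finite T \<and> T \<subseteq> B \<and> (\<lambda>u x. \<Sum>b\<in>T. g b * b u x) \<in> Bd \<longrightarrow> (\<forall>b\<in>T. g b = 0))"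

definition chain_of_tabloid :: "nat \<Rightarrow> 'a::finite_lattice_complete tabloid \<Rightarrow> 'a list" where
  "chain_of_tabloid k T = map (\<lambda>j. Sup (\<Union>r<j. T r)) [1..<k]"

definition f_chain :: "nat \<Rightarrow> ('a::finite_lattice_complete tabloid \<Rightarrow> complex) \<Rightarrow> ('a list \<Rightarrow> complex)" where
  "f_chain k v = (\<lambda>xs. \<Sum>T\<in>{T. v T \<noteq> 0}. v T * (if chain_of_tabloid k T = xs then 1 else 0))"

definition row_lengths :: "nat set \<Rightarrow> nat list" where
  "row_lengths S = (let ss = sorted_list_of_set S in
     map (\<lambda>i. ss ! i - (if i = 0 then 0 else ss ! (i - 1))) [0..<length ss])"

definition in_summand :: "'a \<Rightarrow> ('b \<Rightarrow> complex) \<Rightarrow> ('a \<Rightarrow> 'b \<Rightarrow> complex)" where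
  "in_summand u c = (\<lambda>u'. if u' = u then c else (\<lambda>_. 0))"

end

theory Submission
  imports Defs "HOL-Library.List_Lexorder"
begin

text \<open>No chain of \<open>(0, u)\<close> restricted to \<open>|S| - 1\<close> ranks has more than \<open>|S| - 1\<close> elements, so the
  homology groups in question are the groups of cycles, and it suffices to find leading terms.
  Weigh a rank-selected chain \<open>0 = x\<^sub>0 < x\<^sub>1 < \<dots> < x\<^sub>k = u\<close> by the list of the least possible weights of
  a basis of \<open>x\<^sub>j\<^sub>+\<^sub>1\<close> over \<open>x\<^sub>j\<close>, and compare lists lexicographically. The greedy algorithm for matroids
  shows that this basis is the increasing word of minimal labels from \<open>x\<^sub>j\<close> to \<open>x\<^sub>j\<^sub>+\<^sub>1\<close>. Hence, for a
  standard filling \<open>F\<close> with \<open>NBC\<^sup>+\<close> reading word, the chain of \<open>{F}\<close> occurs in \<open>v\<^sub>F\<close> with coefficient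
  1 and is heavier than every other chain that occurs: a nontrivial column permutation moves
  smaller entries into the first row that it changes. This gives independence. Conversely, let \<open>x\<close>
  be a heaviest chain in the support of a cycle. If the concatenated increasing words of \<open>x\<close> had
  an ascent at \<open>x\<^sub>j\<close>, every other chain agreeing with \<open>x\<close> off position \<open>j\<close> would be heavier, so that the
  face of \<open>x\<close> without \<open>x\<^sub>j\<close> could not cancel in the boundary. So \<open>x\<close> is the chain of a standard
  filling, and the cycle can be reduced.\<close>

section \<open>Rank and semimodularity\<close>

lemma rk_bdd: "finite {length ys | ys :: 'a::finite_lattice_complete list. sorted_wrt (<) ys \<and> (\<forall>y\<in>set ys. bot < y \<and> y \<le> x)}"
proof -
  have "length ys \<le> card (UNIV :: 'a set)" if "sorted_wrt (<) ys" for ys :: "'a list"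
  proof -
    have "distinct ys" using that by (metis distinct_conv_nth nat_neq_iff order_less_irrefl sorted_wrt_nth_less)
    then show ?thesis by (metis card_mono distinct_card finite_UNIV top_greatest)
  qed
  then show ?thesis by (intro finite_subset[OF _ finite_atMost[of "card (UNIV :: 'a set)"]]) auto
qed

lemma length_le_rk:
  "sorted_wrt (<) ys \<Longrightarrow> (\<And>y. y \<in> set ys \<Longrightarrow> bot < y \<and> y \<le> x) \<Longrightarrow> length ys \<le> rk x"
  unfolding rk_def by (rule Max_ge[OF rk_bdd]) auto

lemma rk_attained:
  obtains ys where "sorted_wrt (<) ys" "\<And>y. y \<in> set ys \<Longrightarrow> bot < y \<and> y \<le> x" "length ys = rk x"
proof -
  have "{length ys | ys. sorted_wrt (<) ys \<and> (\<forall>y\<in>set ys. bot < y \<and> y \<le> x)} \<noteq> {}"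
    by (auto intro!: exI[of _ "[]"])
  from Max_in[OF rk_bdd this] show ?thesis
    using that unfolding rk_def by auto
qed

lemma rk_bot: "rk (bot :: 'a::finite_lattice_complete) = 0"
proof -
  obtain ys :: "'a list" where ys: "\<And>y. y \<in> set ys \<Longrightarrow> bot < y \<and> y \<le> bot" "length ys = rk (bot::'a)"
    by (rule rk_attained[of bot]) blast
  have "ys = []" using ys(1) by (metis last_in_set leD)
  then show ?thesis using ys(2) by simp
qed

lemma rk_strict_mono: "x < y \<Longrightarrow> rk x < rk y" for x y :: "'a::finite_lattice_complete"
proof -
  assume "x < y"
  obtain ys where ys: "sorted_wrt (<) ys" "\<And>z. z \<in> set ys \<Longrightarrow> bot < z \<and> z \<le> x" "length ys = rk x"
    by (rule rk_attained[of x]) blast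
  have "length (ys @ [y]) \<le> rk y"
    by (rule length_le_rk)
      (use ys \<open>x < y\<close> in \<open>auto simp: sorted_wrt_append bot_less intro: le_less_trans less_imp_le\<close>)
  with ys(3) show ?thesis by simp
qed

lemma rk_mono: "x \<le> y \<Longrightarrow> rk x \<le> rk y" for x y :: "'a::finite_lattice_complete"
  by (metis le_less rk_strict_mono)

lemma rk_eqD: "x \<le> y \<Longrightarrow> rk y \<le> rk x \<Longrightarrow> x = y" for x y :: "'a::finite_lattice_complete"
  by (metis le_less not_le rk_strict_mono)

text \<open>Exchange step of the Jordan-Dedekind argument: each chain element not above
  \<open>a\<close> is replaced by its join with \<open>a\<close>, and the chain continues unchanged
  once \<open>a\<close> is below it. At most one element is lost, namely when the chain runs through
  \<open>a\<close> itself.\<close>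

lemma less_chain_above_cover:
  fixes z :: "'a::finite_lattice_complete"
  assumes semi: "\<And>a b::'a. covers (inf a b) a \<Longrightarrow> covers b (sup a b)"
  shows "sorted_wrt (<) (z # ys) \<Longrightarrow> \<forall>y\<in>set ys. y \<le> u \<Longrightarrow> covers z a \<Longrightarrow> a \<le> u \<Longrightarrow>
    \<exists>zs. sorted_wrt (<) (a # zs) \<and> (\<forall>y\<in>set zs. y \<le> u) \<and> length ys \<le> Suc (length zs)"
proof (induction ys arbitrary: z a)
  case Nil
  then show ?case by (intro exI[of _ "[]"]) auto
next
  case (Cons y ys)
  consider "a = y" | "a < y" | "\<not> a \<le> y" by fastforce
  then show ?case
  proof cases
    case 1
    then show ?thesis using Cons.prems by (intro exI[of _ ys]) auto
  next
    case 2
    then show ?thesis using Cons.prems by (intro exI[of _ "y # ys"]) auto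
  next
    case 3
    have "z < y" using Cons.prems by simp
    \<comment> \<open>As \<open>a\<close> covers \<open>z\<close> and is not below \<open>y\<close>,
      the meet is \<open>z\<close>; semimodularity then lifts the cover to one of \<open>y\<close>
      by \<open>sup a y\<close>.\<close>
    have "inf a y = z"
      using Cons.prems(3) \<open>z < y\<close> 3 unfolding covers_def
      by (metis inf.absorb_iff1 inf_le1 le_inf_iff less_le)
    then have c: "covers y (sup a y)" using semi Cons.prems(3) by metis
    have "\<not> y \<le> a"
      using Cons.prems(3) \<open>z < y\<close> 3 unfolding covers_def by (metis le_less order_refl)
    then have "a < sup a y" by (simp add: less_le sup.absorb_iff1[symmetric] eq_commute[of a])
    obtain zs where "sorted_wrt (<) (sup a y # zs)" "\<forall>y\<in>set zs. y \<le> u" "length ys \<le> Suc (length zs)"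
      using Cons.IH[OF _ _ c] Cons.prems by auto
    then show ?thesis using \<open>a < sup a y\<close> Cons.prems
      by (intro exI[of _ "sup a y # zs"]) auto
  qed
qed

text \<open>The start \<open>z\<close> is not listed but the end \<open>u\<close> is, so the length
  of the list counts the covers.\<close>

fun saturated_chain :: "'a::order \<Rightarrow> 'a list \<Rightarrow> 'a \<Rightarrow> bool" where
  "saturated_chain z [] u \<longleftrightarrow> z = u"
| "saturated_chain z (x # xs) u \<longleftrightarrow> covers z x \<and> saturated_chain x xs u"

lemma saturated_chain_snoc:
  "saturated_chain z xs u \<Longrightarrow> covers u v \<Longrightarrow> saturated_chain z (xs @ [v]) v"
  by (induction xs arbitrary: z) auto

lemma saturated_chain_le: "saturated_chain z xs u \<Longrightarrow> z \<le> u"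
  by (induction xs arbitrary: z) (fastforce simp: covers_def)+

lemma saturated_chain_sorted:
  "saturated_chain z xs u \<Longrightarrow> sorted_wrt (<) xs \<and> (\<forall>x\<in>set xs. z < x \<and> x \<le> u)"
proof (induction xs arbitrary: z)
  case (Cons x xs)
  then have "z < x" "x \<le> u" using saturated_chain_le by (auto simp: covers_def)
  then show ?case using Cons by (auto intro: less_trans)
qed simp

text \<open>The competing chain is moved above the first element of the saturated chain, which costs
  at most one element; then induction applies.\<close>

lemma saturated_chain_longest:
  fixes z :: "'a::finite_lattice_complete"
  assumes semi: "\<And>a b::'a. covers (inf a b) a \<Longrightarrow> covers b (sup a b)"
  shows "saturated_chain z xs u \<Longrightarrow> sorted_wrt (<) (z # ys) \<Longrightarrow> \<forall>y\<in>set ys. y \<le> u \<Longrightarrow>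
    length ys \<le> length xs"
proof (induction xs arbitrary: z ys)
  case Nil
  then show ?case by (cases ys) auto
next
  case (Cons x xs)
  have "x \<le> u" using Cons.prems saturated_chain_le by auto
  with less_chain_above_cover[OF semi Cons.prems(2,3), of x] Cons.prems(1)
  obtain zs where "sorted_wrt (<) (x # zs)" "\<forall>y\<in>set zs. y \<le> u" "length ys \<le> Suc (length zs)"
    by (metis saturated_chain.simps(2))
  with Cons.IH[of x zs] Cons.prems(1) show ?case by auto
qed

lemma saturated_chain_exists: "\<exists>xs. saturated_chain bot xs x" for x :: "'a::finite_lattice_complete"
proof (induction "rk x" arbitrary: x rule: less_induct)
  case less
  show ?case
  proof (cases "x = bot")
    case True
    then show ?thesis by (intro exI[of _ "[]"]) auto
  next
    case False
    then have "{y. y < x} \<noteq> {}" using bot.not_eq_extremum by blast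
    then obtain y where y: "y < x" "\<And>z. z < x \<Longrightarrow> y \<le> z \<Longrightarrow> y = z"
      using finite_has_maximal[of "{y. y < x}"] by auto
    then have "covers y x" unfolding covers_def by (metis less_le)
    moreover obtain xs where "saturated_chain bot xs y" using less rk_strict_mono[OF y(1)] by blast
    ultimately show ?thesis using saturated_chain_snoc by blast
  qed
qed

lemma rk_eq_length_saturated_chain:
  fixes x :: "'a::finite_lattice_complete"
  assumes semi: "\<And>a b::'a. covers (inf a b) a \<Longrightarrow> covers b (sup a b)"
    and sat: "saturated_chain bot xs x"
  shows "rk x = length xs"
proof (rule antisym)
  show "length xs \<le> rk x"
    using saturated_chain_sorted[OF sat] by (intro length_le_rk) auto
  obtain ys where ys: "sorted_wrt (<) ys" "\<And>y. y \<in> set ys \<Longrightarrow> bot < y \<and> y \<le> x" "length ys = rk x"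
    by (rule rk_attained[of x]) blast
  then have "length ys \<le> length xs"
    by (intro saturated_chain_longest[OF semi sat]) auto
  with ys show "rk x \<le> length xs" by simp
qed

lemma rk_cover:
  fixes x y :: "'a::finite_lattice_complete"
  assumes semi: "\<And>a b::'a. covers (inf a b) a \<Longrightarrow> covers b (sup a b)" and "covers x y"
  shows "rk y = Suc (rk x)"
proof -
  obtain xs where "saturated_chain bot xs x" using saturated_chain_exists by blast
  then show ?thesis
    using rk_eq_length_saturated_chain[OF semi] saturated_chain_snoc[OF _ \<open>covers x y\<close>]
    by (metis length_append_singleton)
qed

section \<open>Minimal labels and greedy words\<close>

text \<open>The label of a cover \<open>z < z \<squnion> a\<close> is its least atom; \<open>min_labels w z as\<close> says that \<open>as\<close> is
  the label word of the chain \<open>z < z \<squnion> a\<^sub>1 < z \<squnion> a\<^sub>1 \<squnion> a\<^sub>2 < \<dots>\<close>.\<close>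
fun min_labels :: "('a::finite_lattice_complete \<Rightarrow> nat) \<Rightarrow> 'a \<Rightarrow> 'a list \<Rightarrow> bool" where
  "min_labels w z [] \<longleftrightarrow> True"
| "min_labels w z (a # as) \<longleftrightarrow> is_atom a \<and> \<not> a \<le> z \<and>
     (\<forall>b. is_atom b \<and> b \<le> sup z a \<and> \<not> b \<le> z \<longrightarrow> w a \<le> w b) \<and> min_labels w (sup z a) as"

text \<open>The greedy algorithm for a minimum weight basis of \<open>y\<close> over
  \<open>z\<close>. In contrast to \<open>min_labels\<close>, each letter is minimal among all atoms
  below \<open>y\<close>, not only among those below the next join.\<close>

fun greedy :: "('a::finite_lattice_complete \<Rightarrow> nat) \<Rightarrow> 'a \<Rightarrow> 'a \<Rightarrow> 'a list \<Rightarrow> bool" where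
  "greedy w y z [] \<longleftrightarrow> z = y"
| "greedy w y z (a # as) \<longleftrightarrow> is_atom a \<and> a \<le> y \<and> \<not> a \<le> z \<and>
     (\<forall>b. is_atom b \<and> b \<le> y \<and> \<not> b \<le> z \<longrightarrow> w a \<le> w b) \<and> greedy w y (sup z a) as"

lemma min_labels_append:
  "min_labels w z (as @ bs) \<longleftrightarrow> min_labels w z as \<and> min_labels w (sup z (Sup (set as))) bs"
  by (induction as arbitrary: z) (auto simp: sup_assoc)

lemma min_labels_atoms: "min_labels w z as \<Longrightarrow> set as \<subseteq> {a. is_atom a}"
  by (induction as arbitrary: z) auto

lemma greedy_Sup: "greedy w y z as \<Longrightarrow> sup z (Sup (set as)) = y"
  by (induction as arbitrary: z) (auto simp flip: sup_assoc)

lemma greedy_atoms: "greedy w y z as \<Longrightarrow> set as \<subseteq> {a. is_atom a}"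
  by (induction as arbitrary: z) auto

lemma greedy_le: "greedy w y z as \<Longrightarrow> j < length as \<Longrightarrow> is_atom b \<Longrightarrow> b \<le> y \<Longrightarrow>
    \<not> b \<le> sup z (Sup (set (take j as))) \<Longrightarrow> w (as ! j) \<le> w b"
proof (induction as arbitrary: z j)
  case (Cons a as)
  then show ?case by (cases j) (auto simp: sup_assoc)
qed simp

text \<open>An atom that enters only after the first step weighs at least as much as the second
  letter, by induction, and the second letter is heavier than the first.\<close>

lemma min_labels_sorted_greedy:
  "min_labels w z as \<Longrightarrow> sorted_wrt (\<lambda>a b. w a < w b) as \<Longrightarrow> sup z (Sup (set as)) = y \<Longrightarrow> greedy w y z as"
proof (induction as arbitrary: z)
  case (Cons a as)
  have g: "greedy w y (sup z a) as" using Cons by (auto simp: sup_assoc)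
  have "w a \<le> w b" if b: "is_atom b" "b \<le> y" "\<not> b \<le> z" for b
  proof (cases "b \<le> sup z a")
    case True
    then show ?thesis using Cons.prems(1) b by auto
  next
    case False
    then obtain a' as' where as: "as = a' # as'" using b Cons.prems(3) by (cases as) auto
    with g False b have "w a' \<le> w b" by auto
    then show ?thesis using Cons.prems(2) as by auto
  qed
  moreover have "a \<le> y" using Cons.prems(3) by (auto intro: le_supI1 le_supI2)
  ultimately show ?case using g Cons.prems by auto
qed simp

lemma greedy_min_labels: "greedy w y z as \<Longrightarrow> min_labels w z as"
proof (induction as arbitrary: z)
  case (Cons a as)
  have "sup (sup z a) (Sup (set as)) = y" using Cons.prems by (intro greedy_Sup) auto
  then have "sup z a \<le> y" by (metis sup_ge1)
  then show ?case using Cons by (auto dest: order_trans)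
qed simp

section \<open>Matroid rank estimates and optimality of greedy words\<close>

locale weighted_geometric_lattice =
  fixes w :: "'a::finite_lattice_complete \<Rightarrow> nat"
  assumes geometric: "geometric_lattice TYPE('a)"
    and inj_weight: "inj_on w {a::'a. is_atom a}"
begin

lemma semimodular: "covers (inf a b) a \<Longrightarrow> covers b (sup a b)" for a b :: 'a
  using geometric unfolding geometric_lattice_def by blast

lemma exists_atom_between:
  fixes y z :: 'a
  assumes "\<not> y \<le> z"
  obtains a where "is_atom a" "a \<le> y" "\<not> a \<le> z"
proof -
  have "\<not> Sup (atoms_below y) \<le> z"
    using geometric assms unfolding geometric_lattice_def by metis
  then show ?thesis using that by (auto simp: atoms_below_def Sup_le_iff)
qed

text \<open>An atom not below \<open>z\<close> meets \<open>z\<close> in \<open>bot\<close>, so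
  semimodularity makes the join a cover of \<open>z\<close>.\<close>

lemma rk_sup_atom:
  fixes z a :: 'a
  assumes "is_atom a" "\<not> a \<le> z"
  shows "rk (sup z a) = Suc (rk z)"
proof -
  have "inf a z = bot"
    using assms unfolding is_atom_def covers_def
    by (metis bot.not_eq_extremum inf.absorb_iff1 inf_le1 less_le)
  then have "covers z (sup z a)"
    using semimodular[of a z] assms(1) unfolding is_atom_def by (simp add: sup_commute)
  with semimodular show ?thesis by (rule rk_cover)
qed

lemma rk_sup_atoms_le:
  fixes z :: 'a
  assumes "B \<subseteq> {a. is_atom a}"
  shows "rk (sup z (Sup B)) \<le> rk z + card B"
proof -
  have "finite B" by simp
  then show ?thesis using assms
  proof induction
    case (insert a B)
    have "rk (sup (sup z (Sup B)) a) \<le> Suc (rk (sup z (Sup B)))"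
      using rk_sup_atom[of a "sup z (Sup B)"] insert.prems
      by (cases "a \<le> sup z (Sup B)") (auto simp: sup_absorb1)
    then show ?case using insert by (simp add: sup.assoc sup.commute sup.left_commute)
  qed simp
qed

text \<open>The atoms of \<open>I - J\<close> raise the rank by at most their number, so
  \<open>J\<close> has to account for the rest.\<close>

lemma rk_Sup_subset_independent:
  fixes I :: "'a set"
  assumes "I \<subseteq> {a. is_atom a}" "rk (Sup I) = card I" "J \<subseteq> I"
  shows "rk (Sup J) = card J"
proof (rule antisym)
  show "rk (Sup J) \<le> card J"
    using rk_sup_atoms_le[of J bot] assms by (auto simp: rk_bot)
  have "card I \<le> rk (sup (Sup J) (Sup (I - J)))"
    using assms by (simp flip: Sup_union_distrib add: Un_absorb1)
  also have "\<dots> \<le> rk (Sup J) + card (I - J)"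
    using assms by (intro rk_sup_atoms_le) auto
  finally show "card J \<le> rk (Sup J)"
    using assms(3) card_mono[of I J] by (simp add: card_Diff_subset)
qed

lemma min_labels_rk: "min_labels w z as \<Longrightarrow> rk (sup z (Sup (set as))) = rk z + length as"
proof (induction as arbitrary: z)
  case (Cons a as)
  have "sup z (Sup (set (a # as))) = sup (sup z a) (Sup (set as))" by (simp add: sup_assoc)
  then show ?case using Cons rk_sup_atom[of a z] by simp
qed simp

lemma greedy_length: "greedy w y z as \<Longrightarrow> rk y = rk z + length as"
  using min_labels_rk greedy_min_labels greedy_Sup by metis

lemma greedy_exists: "z \<le> y \<Longrightarrow> \<exists>as. greedy w y z as"
proof (induction "rk y - rk z" arbitrary: z rule: less_induct)
  case less
  show ?case
  proof (cases "z = y")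
    case True
    then show ?thesis by (intro exI[of _ "[]"]) simp
  next
    case False
    let ?A = "{a. is_atom a \<and> a \<le> y \<and> \<not> a \<le> z}"
    have "\<not> y \<le> z" using False less.prems by auto
    then obtain a0 where "a0 \<in> ?A" by (rule exists_atom_between) auto
    then obtain a where a: "a \<in> ?A" "\<And>b. b \<in> ?A \<Longrightarrow> w a \<le> w b"
      using ex_has_least_nat[of "\<lambda>a. a \<in> ?A" a0 w] by blast
    have le: "sup z a \<le> y" using a less.prems by auto
    then have "rk (sup z a) \<le> rk y" by (rule rk_mono)
    moreover have "rk (sup z a) = Suc (rk z)" using a by (intro rk_sup_atom) auto
    ultimately obtain as where "greedy w y (sup z a) as"
      using less.hyps[OF _ le] by (metis Suc_le_eq diff_less_mono2 lessI)
    then show ?thesis using a by (intro exI[of _ "a # as"]) auto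
  qed
qed

lemma greedy_unique: "greedy w y z as \<Longrightarrow> greedy w y z bs \<Longrightarrow> as = bs"
proof (induction as arbitrary: z bs)
  case Nil
  then show ?case by (cases bs) auto
next
  case (Cons a as)
  then obtain b bs' where bs: "bs = b # bs'" by (cases bs) auto
  have "w a = w b" using Cons.prems bs by (intro antisym) auto
  then have "a = b" using inj_onD[OF inj_weight] Cons.prems bs by auto
  then show ?case using Cons bs by auto
qed

text \<open>A later letter was already a candidate when \<open>a\<close> was chosen, and it is a
  different atom; injective weights make the inequality strict.\<close>

lemma greedy_sorted: "greedy w y z as \<Longrightarrow> sorted_wrt (\<lambda>a b. w a < w b) as"
proof (induction as arbitrary: z)
  case (Cons a as)
  have "w a < w b" if "b \<in> set as" for b
  proof -
    have b: "is_atom b" "b \<le> y" "\<not> b \<le> sup z a"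
    proof -
      obtain us vs where as: "as = us @ b # vs" using \<open>b \<in> set as\<close> by (meson split_list)
      have "min_labels w (sup z a) as" using Cons.prems greedy_min_labels by force
      then show "is_atom b" "\<not> b \<le> sup z a"
        unfolding as min_labels_append by (auto intro: le_supI1)
      show "b \<le> y" using greedy_Sup[OF Cons.prems] as
        by (auto intro: le_supI1 le_supI2)
    qed
    then have "\<not> b \<le> z" by (meson le_supI1)
    then have "w a \<le> w b" using b Cons.prems by auto
    moreover have "a \<noteq> b" using b by auto
    ultimately show ?thesis using inj_onD[OF inj_weight, of a b] b Cons.prems by force
  qed
  then show ?case using Cons by auto
qed simp

text \<open>Matroid exchange: the first \<open>j + 1\<close> letters of \<open>bs\<close> are
  independent over \<open>z\<close>, so they cannot all lie below the join of \<open>z\<close> with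
  \<open>j\<close> greedy letters. One that does not was available to the greedy choice, and it
  weighs at most \<open>bs ! j\<close> because \<open>bs\<close> is sorted.\<close>

lemma greedy_nth_le:
  assumes g: "greedy w y z as" and bs: "sorted (map w bs)" "set bs \<subseteq> {a. is_atom a}"
    and rk: "rk (sup z (Sup (set bs))) = rk z + length bs" and le: "sup z (Sup (set bs)) \<le> y"
    and j: "j < length bs"
  shows "w (as ! j) \<le> w (bs ! j)"
proof -
  have "rk z + length bs \<le> rk z + length as"
    using rk_mono[OF le] greedy_length[OF g] rk by simp
  then have jl: "j < length as" using j by simp
  let ?z = "sup z (Sup (set (take j as)))" and ?B = "set (take (Suc j) bs)"
  have "\<exists>b\<in>?B. \<not> b \<le> ?z"
  proof (rule ccontr)
    assume "\<not> ?thesis"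
    then have "sup z (Sup ?B) \<le> ?z" by (auto simp: Sup_le_iff)
    then have "rk (sup z (Sup ?B)) \<le> rk ?z" by (rule rk_mono)
    also have "\<dots> \<le> rk z + j"
    proof -
      have "rk ?z \<le> rk z + card (set (take j as))"
        using greedy_atoms[OF g] set_take_subset by (intro rk_sup_atoms_le) fast
      then show ?thesis using card_length[of "take j as"] by simp
    qed
    finally have 1: "rk (sup z (Sup ?B)) \<le> rk z + j" .
    \<comment> \<open>The remaining letters add at most \<open>length bs - Suc j\<close> to the
      rank, one too few for the assumed rank of the whole word.\<close>
    have "set bs = ?B \<union> set (drop (Suc j) bs)" by (metis append_take_drop_id set_append)
    then have "rk z + length bs = rk (sup (sup z (Sup ?B)) (Sup (set (drop (Suc j) bs))))"
      using rk by (simp add: Sup_union_distrib sup_assoc)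
    also have "\<dots> \<le> rk (sup z (Sup ?B)) + card (set (drop (Suc j) bs))"
      using bs(2) set_drop_subset by (intro rk_sup_atoms_le) fast
    also have "\<dots> \<le> rk z + j + (length bs - Suc j)"
      using 1 card_length[of "drop (Suc j) bs"] by simp
    finally show False using j by simp
  qed
  then obtain i where i: "i \<le> j" "\<not> bs ! i \<le> ?z"
    by (metis in_set_conv_nth length_take less_Suc_eq_le min_less_iff_conj nth_take)
  have "bs ! i \<in> set bs" using i j by simp
  then have "w (as ! j) \<le> w (bs ! i)"
    using bs(2) le i(2) by (intro greedy_le[OF g jl]) (auto simp: Sup_le_iff)
  also have "\<dots> \<le> w (bs ! j)"
    using bs(1) i j sorted_nth_mono[of "map w bs" i j] by simp
  finally show ?thesis .
qed

text \<open>Sorting \<open>bs\<close> by weight allows a comparison letter by letter. Only a prefix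
  of \<open>as\<close> is used, so that \<open>bs\<close> may span less than
  \<open>y\<close>.\<close>

lemma greedy_weight_le:
  assumes "greedy w y z as" "set bs \<subseteq> {a. is_atom a}"
    and "rk (sup z (Sup (set bs))) = rk z + length bs" "sup z (Sup (set bs)) \<le> y"
  shows "sum_list (map w (take (length bs) as)) \<le> sum_list (map w bs)"
proof -
  let ?bs = "sort_key w bs"
  have "length bs \<le> length as"
    using rk_mono[OF assms(4)] greedy_length[OF assms(1)] assms(3) by simp
  have "sum_list (map w (take (length bs) as)) \<le> sum_list (map w ?bs)"
    using \<open>length bs \<le> length as\<close> assms greedy_nth_le[OF assms(1), of ?bs]
    by (intro sum_list_mono2) auto
  also have "\<dots> = sum_list (map w bs)"
    by (metis mset_map mset_sort sum_mset_sum_list)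
  finally show ?thesis .
qed

text \<open>Letterwise inequalities with equal sums are equalities, and injective weights then
  identify the atoms.\<close>

lemma greedy_weight_eqD:
  assumes g: "greedy w y z as" and bs: "set bs \<subseteq> {a. is_atom a}"
    and rk: "rk (sup z (Sup (set bs))) = rk z + length bs" and le: "sup z (Sup (set bs)) \<le> y"
    and eq: "sum_list (map w (take (length bs) as)) = sum_list (map w bs)"
  shows "set (take (length bs) as) = set bs"
proof -
  let ?as = "take (length bs) as" and ?bs = "sort_key w bs"
  have len: "length bs \<le> length as"
    using rk_mono[OF le] greedy_length[OF g] rk by simp
  have nth: "w (?as ! j) \<le> w (?bs ! j)" if "j < length bs" for j
    using greedy_nth_le[OF g, of ?bs j] bs rk le that by simp
  have sums: "(\<Sum>j<length bs. w (?as ! j)) = (\<Sum>j<length bs. w (?bs ! j))"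
  proof -
    have "sum_list (map w ?bs) = sum_list (map w bs)"
      by (metis mset_map mset_sort sum_mset_sum_list)
    then have "sum_list (map w ?as) = sum_list (map w ?bs)" using eq by simp
    then show ?thesis using len by (simp add: sum_list_sum_nth atLeast0LessThan)
  qed
  have "?as ! j = ?bs ! j" if j: "j < length bs" for j
  proof -
    have "w (?as ! j) = w (?bs ! j)"
      using sum_mono_inv[OF sums, of j] nth j by auto
    moreover have "?as ! j \<in> set as" using j len by simp
    moreover have "?bs ! j \<in> set bs" using j nth_mem[of j ?bs] by simp
    ultimately show ?thesis using inj_onD[OF inj_weight] greedy_atoms[OF g] bs by blast
  qed
  then have "?as = ?bs" using len by (intro nth_equalityI) auto
  then show ?thesis by simp
qed

end

section \<open>Triangular families of cycles\<close>

text \<open>Gaussian elimination. \<open>lead_max\<close> makes every heaviest position in the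
  support of an element of \<open>Z\<close> the lead of some family member, which gives spanning;
  strictness in \<open>lead_less\<close> gives independence. Other positions may tie in weight.
  Equal leads yield equal members rather than equal indices, since different fillings can agree on
  the ribbon.\<close>

lemma homology_basis_triangular:
  fixes Z :: "('i \<Rightarrow> 'j \<Rightarrow> complex) set" and W :: "'i \<Rightarrow> 'j \<Rightarrow> 'w::linorder"
    and \<Phi> :: "'k \<Rightarrow> 'i \<Rightarrow> 'j \<Rightarrow> complex" and lead :: "'k \<Rightarrow> 'i \<times> 'j"
  assumes finX: "finite X" and supp: "\<And>z u x. z \<in> Z \<Longrightarrow> z u x \<noteq> 0 \<Longrightarrow> (u, x) \<in> X"
    and diff: "\<And>z i g. z \<in> Z \<Longrightarrow> i \<in> I \<Longrightarrow> (\<lambda>u x. z u x - g * \<Phi> i u x) \<in> Z"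
    and Bd: "Bd = {\<lambda>_ _. 0}"
    and sub: "\<And>i. i \<in> I \<Longrightarrow> \<Phi> i \<in> Z"
    and lead_1: "\<And>i u x. i \<in> I \<Longrightarrow> lead i = (u, x) \<Longrightarrow> \<Phi> i u x = 1"
    and lead_less: "\<And>i u x. i \<in> I \<Longrightarrow> \<Phi> i u x \<noteq> 0 \<Longrightarrow> lead i \<noteq> (u, x) \<Longrightarrow>
          W u x < case_prod W (lead i)"
    and lead_inj: "\<And>i j. i \<in> I \<Longrightarrow> j \<in> I \<Longrightarrow> lead i = lead j \<Longrightarrow> \<Phi> i = \<Phi> j"
    and lead_max: "\<And>z u x. z \<in> Z \<Longrightarrow> z u x \<noteq> 0 \<Longrightarrow> (\<And>y. z u y \<noteq> 0 \<Longrightarrow> W u y \<le> W u x) \<Longrightarrow>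
          \<exists>i\<in>I. lead i = (u, x)"
  shows "homology_basis Z Bd (\<Phi> ` I)"
proof -
  \<comment> \<open>Induction on a finite set \<open>A\<close> that contains the support of
    \<open>z\<close> and is closed under passing to strictly lighter positions of \<open>X\<close>.
    Each round drops a heaviest position; closure ensures that subtracting a multiple of a member
    creates no support outside \<open>A\<close>.\<close>
  have span: "\<exists>T g. finite T \<and> T \<subseteq> \<Phi> ` I \<and> (\<lambda>u x. z u x - (\<Sum>b\<in>T. g b * b u x)) = (\<lambda>_ _. 0)"
    if "finite A" "z \<in> Z" "\<And>u x. z u x \<noteq> 0 \<Longrightarrow> (u, x) \<in> A"
      "\<And>u x v y. (u, x) \<in> A \<Longrightarrow> (v, y) \<in> X \<Longrightarrow> W v y < W u x \<Longrightarrow> (v, y) \<in> A"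
    for A z
    using that
  proof (induction "card A" arbitrary: A z)
    case 0
    then show ?case by (intro exI[of _ "{}"]) auto
  next
    case (Suc n)
    have "finite (case_prod W ` A)" "case_prod W ` A \<noteq> {}" using Suc.hyps Suc.prems by auto
    from Max_in[OF this] obtain p where p: "p \<in> A" "case_prod W p = Max (case_prod W ` A)"
      by auto
    obtain u x where ux: "p = (u, x)" by fastforce
    have top: "W v y \<le> W u x" if "(v, y) \<in> A" for v y
    proof -
      have "case_prod W (v, y) \<le> Max (case_prod W ` A)"
        using that \<open>finite (case_prod W ` A)\<close> by (intro Max_ge imageI)
      then show ?thesis using p ux by simp
    qed
    let ?A = "A - {(u, x)}"
    have cA: "n = card ?A" "finite ?A" using Suc.hyps Suc.prems p ux by auto
    have down: "(v', y') \<in> ?A" if "(v, y) \<in> ?A" "(v', y') \<in> X" "W v' y' < W v y" for v y v' y'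
    proof -
      have "(v, y) \<in> A" using that(1) by simp
      then have "W v y \<le> W u x" by (rule top)
      then have "(v', y') \<noteq> (u, x)" using that(3) by auto
      moreover have "(v', y') \<in> A" using \<open>(v, y) \<in> A\<close> that(2,3) by (rule Suc.prems(4))
      ultimately show ?thesis by simp
    qed
    show ?case
    proof (cases "z u x = 0")
      case True
      show ?thesis
      proof (rule Suc.hyps(1)[of ?A z, OF cA Suc.prems(2)])
        show "(v', y') \<in> ?A" if "(v, y) \<in> ?A" "(v', y') \<in> X" "W v' y' < W v y" for v y v' y'
          using that by (rule down)
        show "(v, y) \<in> ?A" if "z v y \<noteq> 0" for v y using that True Suc.prems(3) by auto
      qed
    next
      case False
      obtain i where i: "i \<in> I" "lead i = (u, x)"
        using lead_max[OF Suc.prems(2) False] top Suc.prems(3) by metis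
      define c where "c = z u x"
      let ?z = "\<lambda>v y. z v y - c * \<Phi> i v y"
      have zZ: "?z \<in> Z" using diff Suc.prems(2) i(1) .
      have below: "(v, y) \<in> ?A" if "?z v y \<noteq> 0" for v y
      proof -
        have "(v, y) \<noteq> (u, x)" using lead_1[OF i] that by (auto simp: c_def)
        moreover have "(v, y) \<in> A"
        proof (cases "\<Phi> i v y = 0")
          case True
          then show ?thesis using that Suc.prems(3) by auto
        next
          case False
          then have "W v y < W u x" using lead_less[OF i(1) False] i(2) \<open>(v, y) \<noteq> (u, x)\<close> by auto
          then show ?thesis using Suc.prems(4)[of u x v y] p ux supp[OF sub[OF i(1)] False] by auto
        qed
        ultimately show ?thesis by auto
      qed
      have "\<exists>T g. finite T \<and> T \<subseteq> \<Phi> ` I \<and> (\<lambda>u x. ?z u x - (\<Sum>b\<in>T. g b * b u x)) = (\<lambda>_ _. 0)"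
      proof (rule Suc.hyps(1)[of ?A ?z, OF cA zZ])
        show "(v', y') \<in> ?A" if "(v, y) \<in> ?A" "(v', y') \<in> X" "W v' y' < W v y" for v y v' y'
          using that by (rule down)
        show "(v, y) \<in> ?A" if "?z v y \<noteq> 0" for v y using that by (rule below)
      qed
      then obtain T g where T: "finite T" "T \<subseteq> \<Phi> ` I"
        "(\<lambda>u x. ?z u x - (\<Sum>b\<in>T. g b * b u x)) = (\<lambda>_ _. 0)"
        by (elim exE conjE)
      \<comment> \<open>\<open>\<Phi> i\<close> may already belong to \<open>T\<close>; then
        \<open>c\<close> is added to its old coefficient.\<close>
      define g' where "g' = (\<lambda>b. (if b \<in> T then g b else 0) + (if b = \<Phi> i then c else 0))"
      have "(\<Sum>b\<in>insert (\<Phi> i) T. g' b * b v y) = (\<Sum>b\<in>T. g b * b v y) + c * \<Phi> i v y" for v y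
      proof -
        have "(\<Sum>b\<in>insert (\<Phi> i) T. g' b * b v y) =
          (\<Sum>b\<in>insert (\<Phi> i) T. if b \<in> T then g b * b v y else 0) +
          (\<Sum>b\<in>insert (\<Phi> i) T. if b = \<Phi> i then c * b v y else 0)"
          unfolding sum.distrib[symmetric] by (intro sum.cong refl) (simp add: g'_def distrib_right)
        also have "(\<Sum>b\<in>insert (\<Phi> i) T. if b \<in> T then g b * b v y else 0) = (\<Sum>b\<in>T. g b * b v y)"
          using T(1) by (simp add: sum.inter_restrict[symmetric] Int_absorb1 subset_insertI)
        also have "(\<Sum>b\<in>insert (\<Phi> i) T. if b = \<Phi> i then c * b v y else 0) = c * \<Phi> i v y"
          using T(1) by (subst sum.delta) auto
        finally show ?thesis .
      qed
      then have "(\<lambda>u x. z u x - (\<Sum>b\<in>insert (\<Phi> i) T. g' b * b u x)) = (\<lambda>_ _. 0)"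
        using T(3) by (simp add: fun_eq_iff algebra_simps)
      then show ?thesis using T i by (intro exI[of _ "insert (\<Phi> i) T"] exI[of _ g']) auto
    qed
  qed
  \<comment> \<open>Among the members with nonzero coefficient, take one with a heaviest lead.
    Another such member that is nonzero at this lead would have a strictly heavier lead, so a single
    nonzero coefficient is left at that position.\<close>
  have indep: "g b = 0" if T: "finite T" "T \<subseteq> \<Phi> ` I" "\<And>u x. (\<Sum>b\<in>T. g b * b u x) = 0" and b: "b \<in> T"
    for T g b
  proof (rule ccontr)
    assume "g b \<noteq> 0"
    have "\<forall>b\<in>T. \<exists>i. i \<in> I \<and> \<Phi> i = b" using T(2) by blast
    then obtain ix where ix: "\<And>b. b \<in> T \<Longrightarrow> ix b \<in> I" "\<And>b. b \<in> T \<Longrightarrow> \<Phi> (ix b) = b"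
      unfolding Bex_def bchoice_iff by blast
    let ?N = "{b\<in>T. g b \<noteq> 0}" and ?W = "\<lambda>b. case_prod W (lead (ix b))"
    have fin: "finite (?W ` ?N)" "?W ` ?N \<noteq> {}" using T(1) b \<open>g b \<noteq> 0\<close> by auto
    from Max_in[OF this] obtain a where a: "a \<in> ?N" "?W a = Max (?W ` ?N)"
      by (elim imageE) (simp only:)
    obtain u x where ux: "lead (ix a) = (u, x)" by fastforce
    have zero: "g b * b u x = 0" if "b \<in> T - {a}" for b
    proof (rule ccontr)
      assume nz: "g b * b u x \<noteq> 0"
      then have bN: "b \<in> ?N" using that by auto
      have "?W b \<le> ?W a" unfolding a(2) using bN by (intro Max_ge[OF fin(1)]) auto
      moreover have "lead (ix b) \<noteq> (u, x)"
      proof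
        assume "lead (ix b) = (u, x)"
        moreover have "b \<in> T" "a \<in> T" using that a(1) by auto
        ultimately have "\<Phi> (ix b) = \<Phi> (ix a)" using lead_inj[of "ix b" "ix a"] ix ux by simp
        then have "b = a" using ix(2)[OF \<open>b \<in> T\<close>] ix(2)[OF \<open>a \<in> T\<close>] by simp
        then show False using that by simp
      qed
      then have "W u x < ?W b" using lead_less[of "ix b" u x] ix[of b] nz that by simp
      ultimately show False using ux by simp
    qed
    have "0 = (\<Sum>b\<in>T. g b * b u x)" using T(3) by simp
    also have "\<dots> = g a * a u x + (\<Sum>b\<in>T - {a}. g b * b u x)" using a(1) by (intro sum.remove[OF T(1)]) simp
    also have "(\<Sum>b\<in>T - {a}. g b * b u x) = 0" using zero by (rule sum.neutral[rule_format])
    also have "a u x = 1" using lead_1[OF _ ux] ix[of a] a(1) by auto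
    finally show False using a(1) by simp
  qed
  show ?thesis
    unfolding homology_basis_def Bd
  proof (intro conjI ballI allI impI)
    show "\<Phi> ` I \<subseteq> Z" using sub by auto
    show "\<exists>T g. finite T \<and> T \<subseteq> \<Phi> ` I \<and> (\<lambda>u x. z u x - (\<Sum>b\<in>T. g b * b u x)) \<in> {\<lambda>_ _. 0}" if "z \<in> Z" for z
      using span[OF finX that] supp[OF that] by auto
    show "g b = 0" if "finite T \<and> T \<subseteq> \<Phi> ` I \<and> (\<lambda>u x. \<Sum>b\<in>T. g b * b u x) \<in> {\<lambda>_ _. 0}" "b \<in> T" for T g b
      using that by (intro indep[of T g b]) (auto simp: fun_eq_iff)
  qed
qed

section \<open>Fillings of ribbons\<close>

definition row :: "nat list \<Rightarrow> (nat \<times> nat \<Rightarrow> 'a) \<Rightarrow> nat \<Rightarrow> 'a list" where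
  "row rs F r = map (\<lambda>c. F (c, r)) [rstart rs r..<rstart rs r + rs ! r]"

definition rows_below :: "nat list \<Rightarrow> (nat \<times> nat \<Rightarrow> 'a) \<Rightarrow> nat \<Rightarrow> 'a set" where
  "rows_below rs F j = (\<Union>r<j. tabloid rs F r)"

lemma reading_word_rows: "reading_word rs F = concat (map (row rs F) [0..<length rs])"
  by (simp add: reading_word_def row_def[abs_def])

lemma length_row [simp]: "length (row rs F r) = rs ! r"
  by (simp add: row_def)

lemma rib_row: "r < length rs \<Longrightarrow> {x \<in> rib rs. snd x = r} = (\<lambda>c. (c, r)) ` {rstart rs r..<rstart rs r + rs ! r}"
  by (auto simp: rib_def image_iff)

lemma set_row: "r < length rs \<Longrightarrow> set (row rs F r) = tabloid rs F r"
  by (simp add: row_def tabloid_def rib_row image_image)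

lemma rows_below_image: "j \<le> length rs \<Longrightarrow> rows_below rs F j = F ` {x \<in> rib rs. snd x < j}"
  by (auto simp: rows_below_def tabloid_def)

lemma rows_below_length: "rows_below rs F (length rs) = F ` rib rs"
  by (subst rows_below_image) (auto simp: rib_def)

lemma rows_below_0 [simp]: "rows_below rs F 0 = {}"
  by (simp add: rows_below_def)

lemma rows_below_Suc: "rows_below rs F (Suc r) = rows_below rs F r \<union> tabloid rs F r"
  by (auto simp: rows_below_def less_Suc_eq)

lemma rib_below_Suc: "{x \<in> rib rs. snd x < Suc j} = {x \<in> rib rs. snd x < j} \<union> {x \<in> rib rs. snd x = j}"
  by auto

lemma finite_card_rib_below:
  "j \<le> length rs \<Longrightarrow> finite {x \<in> rib rs. snd x < j} \<and> card {x \<in> rib rs. snd x < j} = (\<Sum>r<j. rs ! r)"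
proof (induction j)
  case (Suc j)
  have "card {x \<in> rib rs. snd x = j} = rs ! j" "finite {x \<in> rib rs. snd x = j}"
    using Suc.prems by (auto simp: rib_row card_image inj_on_def)
  then show ?case unfolding rib_below_Suc using Suc by (subst card_Un_disjoint) auto
qed simp

lemma rib_below_length: "{x \<in> rib rs. snd x < length rs} = rib rs"
  by (auto simp: rib_def)

lemma finite_rib: "finite (rib rs)"
  using finite_card_rib_below[of "length rs" rs] by (simp add: rib_below_length)

lemma card_rib: "card (rib rs) = (\<Sum>r<length rs. rs ! r)"
  using finite_card_rib_below[of "length rs" rs] by (simp add: rib_below_length)

lemma length_reading_word: "length (reading_word rs F) = card (rib rs)"
  unfolding card_rib by (simp add: reading_word_rows length_concat o_def sum_list_sum_nth atLeast0LessThan)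

lemma set_reading_word: "set (reading_word rs F) = F ` rib rs"
  unfolding reading_word_rows by (auto simp: set_row tabloid_def) (force simp: rib_def)

lemma inj_on_reading_word: "distinct (reading_word rs F) \<Longrightarrow> inj_on F (rib rs)"
  by (metis distinct_card eq_card_imp_inj_on finite_rib length_reading_word set_reading_word)

lemma finite_col_perms: "finite (col_perms rs)"
  by (rule finite_subset[OF _ finite_permutations[OF finite_rib[of rs]]]) (auto simp: col_perms_def)

text \<open>Several column permutations may share a tabloid, so \<open>v_F\<close> collects their
  signs; exchanging the sums over tabloids and permutations spreads them out again.\<close>

lemma f_chain_v_F:
  "f_chain k (v_F rs F) xs =
    (\<Sum>\<pi>\<in>col_perms rs. if chain_of_tabloid k (tabloid rs (F \<circ> \<pi>)) = xs then of_int (sign \<pi>) else 0)"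
proof -
  let ?t = "\<lambda>\<pi>. tabloid rs (F \<circ> \<pi>)" and ?C = "col_perms rs"
  let ?d = "\<lambda>T. if chain_of_tabloid k T = xs then 1 else (0::complex)"
  have "f_chain k (v_F rs F) xs = (\<Sum>T\<in>?t ` ?C. v_F rs F T * ?d T)"
    unfolding f_chain_def
  proof (rule sum.mono_neutral_left)
    show "{T. v_F rs F T \<noteq> 0} \<subseteq> ?t ` ?C"
      unfolding v_F_def by (auto elim!: sum.not_neutral_contains_not_neutral split: if_splits)
  qed (auto simp: finite_col_perms)
  also have "\<dots> = (\<Sum>T\<in>?t ` ?C. \<Sum>\<pi>\<in>?C. if ?t \<pi> = T then of_int (sign \<pi>) * ?d T else 0)"
    unfolding v_F_def sum_distrib_right by (intro sum.cong refl) simp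
  also have "\<dots> = (\<Sum>\<pi>\<in>?C. \<Sum>T\<in>?t ` ?C. if ?t \<pi> = T then of_int (sign \<pi>) * ?d T else 0)"
    by (rule sum.swap)
  also have "\<dots> = (\<Sum>\<pi>\<in>?C. of_int (sign \<pi>) * ?d (?t \<pi>))"
    by (intro sum.cong refl) (simp add: finite_col_perms)
  finally show ?thesis by (simp add: if_distrib cong: if_cong)
qed

lemma f_chain_v_F_nonzeroD:
  assumes "f_chain k (v_F rs F) xs \<noteq> 0"
  shows "\<exists>\<pi>\<in>col_perms rs. chain_of_tabloid k (tabloid rs (F \<circ> \<pi>)) = xs"
proof (rule ccontr)
  assume "\<not> ?thesis"
  then have "f_chain k (v_F rs F) xs = 0" unfolding f_chain_v_F by (intro sum.neutral) auto
  with assms show False by simp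
qed

text \<open>Fillings are functions on all pairs of numbers, but column permutations keep the ribbon,
  so only the values on its cells matter.\<close>

lemma v_F_cong:
  assumes "\<And>x. x \<in> rib rs \<Longrightarrow> F x = G x"
  shows "v_F rs F = v_F rs G"
proof -
  have "tabloid rs (F \<circ> \<pi>) = tabloid rs (G \<circ> \<pi>)" if "\<pi> \<in> col_perms rs" for \<pi>
    using that assms permutes_in_image[of \<pi> "rib rs"]
    by (auto simp: tabloid_def col_perms_def fun_eq_iff intro!: image_cong)
  then show ?thesis unfolding v_F_def by (intro ext sum.cong) auto
qed

section \<open>The image of \<open>v_F\<close> is a cycle\<close>

lemma length_chain_of_tabloid [simp]: "length (chain_of_tabloid k T) = k - 1"
  by (simp add: chain_of_tabloid_def)

lemma nth_chain_of_tabloid: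
  "i < k - 1 \<Longrightarrow> chain_of_tabloid k (tabloid rs F) ! i = Sup (rows_below rs F (Suc i))"
  by (simp add: chain_of_tabloid_def rows_below_def)

lemma remove_nth_eqI:
  assumes "length xs = length ys" "\<And>i. i < length xs \<Longrightarrow> i \<noteq> r \<Longrightarrow> xs ! i = ys ! i"
  shows "take r xs @ drop (Suc r) xs = take r ys @ drop (Suc r) ys"
proof -
  have "take r xs = take r ys" using assms by (intro nth_equalityI) auto
  moreover have "drop (Suc r) xs = drop (Suc r) ys" using assms by (intro nth_equalityI) auto
  ultimately show ?thesis by simp
qed

text \<open>This is the column in which two successive rows meet: last cell of the lower row, first
  cell of the upper one.\<close>

lemma first_of_row_in_rib:
  assumes "Suc r < length rs" "\<And>r. r < length rs \<Longrightarrow> 1 \<le> rs ! r"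
  shows "(rstart rs (Suc r), r) \<in> rib rs" "(rstart rs (Suc r), Suc r) \<in> rib rs"
  using assms(1) assms(2)[of r] assms(2)[of "Suc r"] by (auto simp: rib_def)

lemma finite_simplices: "finite (simplices Q n)" for Q :: "'a::{order,finite} set"
  by (rule finite_subset[OF _ finite_lists_length_eq[of UNIV n]]) (auto simp: simplices_def)

text \<open>For each vertex \<open>i\<close>, the transposition of the two cells where rows
  \<open>i\<close> and \<open>Suc i\<close> meet changes no other vertex and reverses the sign, so
  the faces omitting vertex \<open>i\<close> cancel in pairs.\<close>

lemma boundary_f_chain_v_F:
  fixes F :: "nat \<times> nat \<Rightarrow> 'a::finite_lattice_complete"
  assumes pos: "\<And>r. r < length rs \<Longrightarrow> 1 \<le> rs ! r"
    and chains: "\<And>\<pi>. \<pi> \<in> col_perms rs \<Longrightarrow>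
      chain_of_tabloid (length rs) (tabloid rs (F \<circ> \<pi>)) \<in> simplices Q (length rs - 1)"
  shows "boundary Q (length rs - 1) (f_chain (length rs) (v_F rs F)) = (\<lambda>_. 0)"
proof
  fix ys :: "'a list"
  let ?k = "length rs" and ?C = "col_perms rs"
  let ?ch = "\<lambda>\<pi>. chain_of_tabloid ?k (tabloid rs (F \<circ> \<pi>))"
  let ?D = "\<lambda>i xs. if take i xs @ drop (Suc i) xs = ys then 1 else (0::complex)"
  let ?s = "\<lambda>\<pi>. of_int (sign \<pi>) :: complex"
  have cancel: "(\<Sum>\<pi>\<in>?C. ?s \<pi> * ?D i (?ch \<pi>)) = 0" if i: "i < ?k - 1" for i
  proof -
    let ?p = "(rstart rs (Suc i), i)" and ?q = "(rstart rs (Suc i), Suc i)"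
    let ?\<tau> = "transpose ?p ?q"
    have pq: "?p \<in> rib rs" "?q \<in> rib rs" using first_of_row_in_rib[of i rs] i pos by auto
    have \<tau>: "?\<tau> permutes rib rs" using pq by (rule permutes_swap_id)
    have in_C: "\<pi> \<circ> ?\<tau> \<in> ?C" if "\<pi> \<in> ?C" for \<pi>
    proof -
      have "fst ((\<pi> \<circ> ?\<tau>) x) = fst x" for x
      proof -
        have "fst (\<pi> (?\<tau> x)) = fst (?\<tau> x)" using that unfolding col_perms_def by blast
        also have "\<dots> = fst x" unfolding transpose_def by auto
        finally show ?thesis by simp
      qed
      then show ?thesis using that permutes_compose[OF \<tau>] by (auto simp: col_perms_def)
    qed
    have bij: "bij_betw (\<lambda>\<pi>. \<pi> \<circ> ?\<tau>) ?C ?C"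
      by (rule bij_betwI[where g = "\<lambda>\<pi>. \<pi> \<circ> ?\<tau>"]) (use in_C in \<open>auto simp: o_assoc[symmetric]\<close>)
    have sgn: "sign (\<pi> \<circ> ?\<tau>) = - sign \<pi>" if "\<pi> \<in> ?C" for \<pi>
    proof -
      have "permutation \<pi>" using that finite_rib permutation_permutes by (auto simp: col_perms_def)
      then show ?thesis by (simp add: sign_compose permutation_swap_id sign_swap_id)
    qed
    \<comment> \<open>List position \<open>i\<close> holds the join of the rows below
      \<open>Suc i\<close>. For every other \<open>j\<close>, the two swapped cells are both inside
      or both outside the rows below \<open>j\<close>.\<close>
    have faces_eq: "?D i (?ch (\<pi> \<circ> ?\<tau>)) = ?D i (?ch \<pi>)" for \<pi>
    proof -
      have "rows_below rs (F \<circ> (\<pi> \<circ> ?\<tau>)) j = rows_below rs (F \<circ> \<pi>) j" if "j \<noteq> Suc i" "j \<le> ?k" for j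
      proof -
        let ?R = "{x \<in> rib rs. snd x < j}"
        have "?\<tau> ` ?R = ?R"
        proof (cases "j \<le> i")
          case True
          then have "?\<tau> x = x" if "x \<in> ?R" for x using that by (auto simp: transpose_def)
          then show ?thesis by force
        next
          case False
          then have "?p \<in> ?R" "?q \<in> ?R" using pq \<open>j \<noteq> Suc i\<close> by auto
          then show ?thesis by (intro permutes_image permutes_swap_id)
        qed
        then have "(F \<circ> \<pi>) ` ?\<tau> ` ?R = (F \<circ> \<pi>) ` ?R" by (rule arg_cong)
        then show ?thesis using that(2) by (simp only: rows_below_image image_comp o_assoc)
      qed
      then show ?thesis
        using remove_nth_eqI[of "?ch (\<pi> \<circ> ?\<tau>)" "?ch \<pi>" i] by (simp add: nth_chain_of_tabloid)
    qed
    \<comment> \<open>Reindexing by the transposition shows that the sum is its own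
      negative.\<close>
    have "(\<Sum>\<pi>\<in>?C. ?s \<pi> * ?D i (?ch \<pi>)) = (\<Sum>\<pi>\<in>?C. ?s (\<pi> \<circ> ?\<tau>) * ?D i (?ch (\<pi> \<circ> ?\<tau>)))"
      by (rule sum.reindex_bij_betw[OF bij, symmetric])
    also have "\<dots> = (\<Sum>\<pi>\<in>?C. - (?s \<pi> * ?D i (?ch \<pi>)))"
      by (intro sum.cong refl) (simp only: faces_eq sgn of_int_minus mult_minus_left)
    finally have "(\<Sum>\<pi>\<in>?C. ?s \<pi> * ?D i (?ch \<pi>)) = - (\<Sum>\<pi>\<in>?C. ?s \<pi> * ?D i (?ch \<pi>))"
      by (simp add: sum_negf)
    then show ?thesis by simp
  qed
  have "boundary Q (?k - 1) (f_chain ?k (v_F rs F)) ys =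
     (\<Sum>xs\<in>simplices Q (?k - 1). \<Sum>\<pi>\<in>?C. if ?ch \<pi> = xs then ?s \<pi> * (\<Sum>i<?k - 1. (-1) ^ i * ?D i xs) else 0)"
    unfolding boundary_def f_chain_v_F
    by (intro sum.cong refl) (auto simp: sum_distrib_right if_distrib cong: if_cong intro!: sum.cong)
  also have "\<dots> = (\<Sum>\<pi>\<in>?C. ?s \<pi> * (\<Sum>i<?k - 1. (-1) ^ i * ?D i (?ch \<pi>)))"
    by (subst sum.swap, intro sum.cong refl, subst sum.delta'[OF finite_simplices]) (use chains in simp)
  also have "\<dots> = (\<Sum>i<?k - 1. (-1) ^ i * (\<Sum>\<pi>\<in>?C. ?s \<pi> * ?D i (?ch \<pi>)))"
    unfolding sum_distrib_left by (subst sum.swap, intro sum.cong refl) (simp add: mult.left_commute)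
  also have "\<dots> = 0" using cancel by simp
  finally show "boundary Q (?k - 1) (f_chain ?k (v_F rs F)) ys = 0" .
qed

lemma boundary_diff:
  "boundary Q n (\<lambda>x. c x - g * d x) = (\<lambda>ys. boundary Q n c ys - g * boundary Q n d ys)"
  unfolding boundary_def
  by (simp add: fun_eq_iff sum_subtractf sum_distrib_left left_diff_distrib mult.assoc)

lemma cycles_diff: "c \<in> cycles Q n \<Longrightarrow> d \<in> cycles Q n \<Longrightarrow> (\<lambda>x. c x - g * d x) \<in> cycles Q n"
  unfolding cycles_def by (force simp: chain_on_def boundary_diff)

lemma zero_in_cycles: "(\<lambda>_. 0) \<in> cycles Q n"
  by (simp add: cycles_def chain_on_def boundary_def)

text \<open>In the first row that is changed, a column permutation can only bring in entries from
  higher rows, and these are smaller in a standard filling.\<close>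
lemma col_perm_first_moved_row:
  fixes w :: "'a \<Rightarrow> nat"
  assumes std: "standard_filling w rs F" and \<pi>: "\<pi> \<in> col_perms rs" "\<pi> \<noteq> id"
  obtains r where "r < length rs" "\<And>x. x \<in> rib rs \<Longrightarrow> snd x < r \<Longrightarrow> \<pi> x = x"
    "sum_list (map w (row rs (F \<circ> \<pi>) r)) < sum_list (map w (row rs F r))"
proof -
  have perm: "\<pi> permutes rib rs" and col: "\<And>x. fst (\<pi> x) = fst x" using \<pi>(1) by (auto simp: col_perms_def)
  obtain x0 where x0: "\<pi> x0 \<noteq> x0" using \<pi>(2) by fastforce
  define r where "r = (LEAST r. \<exists>c. \<pi> (c, r) \<noteq> (c, r))"
  obtain c where c: "\<pi> (c, r) \<noteq> (c, r)"
  proof -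
    have "\<exists>c. \<pi> (c, snd x0) \<noteq> (c, snd x0)" using x0 by (intro exI[of _ "fst x0"]) simp
    from LeastI[of "\<lambda>r. \<exists>c. \<pi> (c, r) \<noteq> (c, r)", OF this] show ?thesis
      using that unfolding r_def by blast
  qed
  have fixed: "\<pi> x = x" if "snd x < r" for x
  proof -
    have "\<not> (\<exists>c. \<pi> (c, snd x) \<noteq> (c, snd x))"
      by (rule not_less_Least) (use that in \<open>simp add: r_def\<close>)
    then have "\<pi> (fst x, snd x) = (fst x, snd x)" by blast
    then show ?thesis by simp
  qed
  have cr: "(c, r) \<in> rib rs" using c perm by (meson permutes_not_in)
  \<comment> \<open>A cell in a lower row is fixed, so by injectivity it is not also the image of a
    cell of row \<open>r\<close>.\<close>
  have up: "r \<le> snd (\<pi> (c', r))" for c'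
  proof (rule ccontr)
    assume lt: "\<not> ?thesis"
    then have "\<pi> (\<pi> (c', r)) = \<pi> (c', r)" using fixed by simp
    then have "\<pi> (c', r) = (c', r)" using permutes_inj[OF perm] by (simp add: inj_eq)
    then show False using lt by simp
  qed
  have less: "w (F (\<pi> (c', r))) < w (F (c', r))" if "(c', r) \<in> rib rs" "\<pi> (c', r) \<noteq> (c', r)" for c'
  proof -
    obtain r' where r': "\<pi> (c', r) = (c', r')" using col[of "(c', r)"] by (cases "\<pi> (c', r)") auto
    then have "r < r'" using up[of c'] that(2) by auto
    moreover have "(c', r') \<in> rib rs" using permutes_in_image[OF perm] that(1) r' by metis
    ultimately show ?thesis using std that(1) r' unfolding standard_filling_def by auto
  qed
  have "sum_list (map w (row rs (F \<circ> \<pi>) r)) < sum_list (map w (row rs F r))"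
  proof -
    have rl: "r < length rs" using cr by (auto simp: rib_def)
    let ?I = "{rstart rs r..<rstart rs r + rs ! r}"
    have in_rib: "(c', r) \<in> rib rs" if "c' \<in> ?I" for c' using that rl by (auto simp: rib_def)
    have "(\<Sum>c'\<in>?I. w (F (\<pi> (c', r)))) < (\<Sum>c'\<in>?I. w (F (c', r)))"
    proof (rule sum_strict_mono_ex1)
      show "\<forall>c'\<in>?I. w (F (\<pi> (c', r))) \<le> w (F (c', r))"
      proof
        fix c' assume "c' \<in> ?I"
        then show "w (F (\<pi> (c', r))) \<le> w (F (c', r))"
          using less[OF in_rib] by (cases "\<pi> (c', r) = (c', r)") (auto intro: less_imp_le)
      qed
      show "\<exists>c'\<in>?I. w (F (\<pi> (c', r))) < w (F (c', r))"
        using less[OF cr c] cr by (auto simp: rib_def)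
    qed simp
    then show ?thesis by (simp add: row_def o_def interv_sum_list_conv_sum_set_nat)
  qed
  moreover have "r < length rs" using cr by (auto simp: rib_def)
  ultimately show thesis using fixed by (intro that[of r])
qed

section \<open>Label words and standardness read row by row\<close>

lemma min_labels_nth:
  "min_labels w z as \<longleftrightarrow> (\<forall>j<length as. is_atom (as ! j) \<and>
     \<not> as ! j \<le> sup z (Sup (set (take j as))) \<and>
     (\<forall>b. is_atom b \<and> b \<le> sup z (Sup (set (take (Suc j) as))) \<and> \<not> b \<le> sup z (Sup (set (take j as)))
        \<longrightarrow> w (as ! j) \<le> w b))"
proof (induction as arbitrary: z)
  case (Cons a as)
  show ?case
    by (subst min_labels.simps, subst Cons) (simp add: All_less_Suc2 sup_assoc)
qed simp

text \<open>At some step \<open>b\<close> falls below the growing join, and the label of that step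
  is minimal among the atoms that are new there. This supplies the smaller element in the NBC
  condition.\<close>

lemma min_labels_exists_le:
  "min_labels w z as \<Longrightarrow> is_atom b \<Longrightarrow> b \<le> sup z (Sup (set as)) \<Longrightarrow> \<not> b \<le> z \<Longrightarrow> \<exists>a\<in>set as. w a \<le> w b"
proof (induction as arbitrary: z)
  case (Cons a as)
  then show ?case by (cases "b \<le> sup z a") (auto simp flip: sup_assoc)
qed simp

lemma Sup_rows_below_Suc:
  "r < length rs \<Longrightarrow> Sup (rows_below rs F (Suc r)) = sup (Sup (rows_below rs F r)) (Sup (set (row rs F r)))"
  for F :: "nat \<times> nat \<Rightarrow> 'a::finite_lattice_complete"
  by (simp add: rows_below_Suc set_row Sup_union_distrib)

lemma min_labels_rows:
  "n \<le> length rs \<Longrightarrow> min_labels w bot (concat (map (row rs F) [0..<n])) \<longleftrightarrow>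
     (\<forall>r<n. min_labels w (Sup (rows_below rs F r)) (row rs F r))"
proof (induction n)
  case (Suc n)
  have "set (concat (map (row rs F) [0..<n])) = rows_below rs F n"
    using Suc.prems by (auto simp: rows_below_def set_row)
  then show ?case using Suc by (simp add: min_labels_append All_less_Suc conj_commute)
qed simp

text \<open>Nonempty rows have weakly increasing starts, so a cell with another one above it can
  only be the last of its row, right below the start of the next row. A column may still run through
  several rows of length 1.\<close>

lemma column_next_row:
  assumes pos: "\<And>r. r < length rs \<Longrightarrow> 1 \<le> rs ! r"
    and "(c, r) \<in> rib rs" "(c, r') \<in> rib rs" "r < r'"
  shows "c = rstart rs (Suc r)" "(c, Suc r) \<in> rib rs"
proof -
  have mono: "rstart rs (Suc r) \<le> rstart rs (Suc r + d)" if "Suc r + d < length rs" for d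
    using that
  proof (induction d)
    case (Suc d)
    then show ?case using pos[of "Suc r + d"] by simp
  qed simp
  have "r' < length rs" "rstart rs r' \<le> c" using assms by (auto simp: rib_def)
  then have "rstart rs (Suc r) \<le> c" using mono[of "r' - Suc r"] \<open>r < r'\<close> by auto
  then show "c = rstart rs (Suc r)" using assms(2) by (auto simp: rib_def)
  then show "(c, Suc r) \<in> rib rs" using \<open>r' < length rs\<close> \<open>r < r'\<close> pos[of "Suc r"]
    by (auto simp: rib_def simp del: rstart.simps)
qed

lemma row_nth: "rstart rs r \<le> c \<Longrightarrow> c < rstart rs r + rs ! r \<Longrightarrow> row rs F r ! (c - rstart rs r) = F (c, r)"
  using nth_upt[of "rstart rs r" "c - rstart rs r" "rstart rs r + rs ! r"] by (simp add: row_def)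

lemma standard_filling_row_sorted:
  assumes "standard_filling w rs F" "r < length rs"
  shows "sorted_wrt (\<lambda>a b. w a < w b) (row rs F r)"
  using assms unfolding row_def sorted_wrt_map standard_filling_def
  by (auto simp: sorted_wrt_iff_nth_less rib_def)

text \<open>Adjacent rows share only the last cell position of the lower and the first of the upper
  row, so the column condition follows from \<open>desc\<close> by induction on the distance of the
  rows.\<close>

lemma standard_fillingI:
  assumes pos: "\<And>r. r < length rs \<Longrightarrow> 1 \<le> rs ! r"
    and rows: "\<And>r. r < length rs \<Longrightarrow> sorted_wrt (\<lambda>a b. w a < w b) (row rs F r)"
    and desc: "\<And>r. Suc r < length rs \<Longrightarrow> w (hd (row rs F (Suc r))) < w (last (row rs F r))"
  shows "standard_filling w rs F"
  unfolding standard_filling_def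
proof (intro conjI allI impI; elim conjE)
  fix c c' r assume "(c, r) \<in> rib rs" "(c', r) \<in> rib rs" "c < c'"
  then have *: "r < length rs" "rstart rs r \<le> c" "c < c'" "c' < rstart rs r + rs ! r" by (auto simp: rib_def)
  then have "w (row rs F r ! (c - rstart rs r)) < w (row rs F r ! (c' - rstart rs r))"
    by (intro sorted_wrt_nth_less[OF rows]) auto
  then show "w (F (c, r)) < w (F (c', r))" using * by (simp add: row_nth)
next
  fix c r r' assume "(c, r) \<in> rib rs" "(c, r') \<in> rib rs" "r < r'"
  then show "w (F (c, r')) < w (F (c, r))"
  proof (induction "r' - Suc r" arbitrary: r)
    case 0
    then have c: "c = rstart rs (Suc r)" and r: "r' = Suc r" using column_next_row(1)[OF pos] by auto
    have l: "Suc r < length rs" using 0 r by (auto simp: rib_def)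
    have "hd (row rs F (Suc r)) = F (c, Suc r)"
      using pos[of "Suc r"] l c by (simp add: row_def hd_map upt_rec del: rstart.simps)
    moreover have "last (row rs F r) = F (c, r)"
      using pos[of r] l c by (simp add: row_def last_map)
    ultimately show ?case using desc[OF l] r by simp
  next
    case (Suc n)
    have next_row: "c = rstart rs (Suc r)" "(c, Suc r) \<in> rib rs" using column_next_row[OF pos Suc.prems] by auto
    have "w (F (c, r')) < w (F (c, Suc r))" using Suc next_row by (intro Suc.hyps(1)) auto
    also have "\<dots> < w (F (c, r))"
    proof -
      have l: "Suc r < length rs" using next_row by (auto simp: rib_def)
      have "hd (row rs F (Suc r)) = F (c, Suc r)"
        using pos[of "Suc r"] l next_row by (simp add: row_def hd_map upt_rec del: rstart.simps)
      moreover have "last (row rs F r) = F (c, r)"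
        using pos[of r] l next_row by (simp add: row_def last_map)
      ultimately show ?thesis using desc[OF l] by simp
    qed
    finally show ?case .
  qed
qed

section \<open>NBC+ bases as label words\<close>

context weighted_geometric_lattice
begin

text \<open>Injective weights make the minimizer unique, so the definite description in
  \<open>atom_min\<close> denotes it.\<close>

lemma atom_min_eq_iff:
  assumes "X \<subseteq> {a. is_atom a}" "a \<in> X"
  shows "a = atom_min w X \<longleftrightarrow> (\<forall>b\<in>X. w a \<le> w b)"
proof -
  have uniq: "b = c" if "b \<in> X" "c \<in> X" "\<forall>d\<in>X. w b \<le> w d" "\<forall>d\<in>X. w c \<le> w d" for b c
    using that inj_onD[OF inj_weight, of b c] assms(1) by (auto intro: antisym)
  obtain m where m: "m \<in> X" "\<And>b. b \<in> X \<Longrightarrow> w m \<le> w b"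
    using ex_has_least_nat[of "\<lambda>a. a \<in> X" a w] assms(2) by blast
  have "atom_min w X = m"
    unfolding atom_min_def using m uniq by (intro the_equality) blast+
  then show ?thesis using uniq m assms(2) by blast
qed

text \<open>The NBC condition is automatic: the least atom of \<open>[0, u]\<close> is one of the labels.\<close>
lemma nbc_plus_basis_iff:
  "nbc_plus_basis w u as \<longleftrightarrow> min_labels w bot as \<and> Sup (set as) = u"
proof
  assume nbc: "nbc_plus_basis w u as"
  let ?X = "\<lambda>j. atoms_below (Sup (set (take (Suc j) as))) - atoms_below (Sup (set (take j as)))"
  have at: "set as \<subseteq> {a. is_atom a}" and le: "Sup (set as) \<le> u" and dist: "distinct as"
    and len: "length as = rk u" and ind: "rk (Sup (set as)) = card (set as)"
    and mn: "\<And>j. j < length as \<Longrightarrow> as ! j = atom_min w (?X j)"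
    using nbc by (auto simp: nbc_plus_basis_def atoms_below_def nbc_independent_def intro: Sup_least)
  have "Sup (set as) = u"
    using le len ind distinct_card[OF dist] by (intro rk_eqD) auto
  moreover have "min_labels w bot as"
    unfolding min_labels_nth
  proof (intro allI impI)
    fix j assume j: "j < length as"
    \<comment> \<open>Prefixes of an independent word are independent, so every letter raises the
      rank and cannot lie below the join of its predecessors.\<close>
    have rk_take: "rk (Sup (set (take i as))) = i" if "i \<le> length as" for i
      using rk_Sup_subset_independent[OF at ind set_take_subset[of i]] that dist
      by (simp add: distinct_card)
    have ins: "set (take (Suc j) as) = insert (as ! j) (set (take j as))"
      using j by (simp add: take_Suc_conv_app_nth)
    have not_le: "\<not> as ! j \<le> Sup (set (take j as))"
    proof
      assume "as ! j \<le> Sup (set (take j as))"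
      then have "Sup (set (take (Suc j) as)) = Sup (set (take j as))"
        unfolding ins by (simp add: sup_absorb2)
      then show False using rk_take[of j] rk_take[of "Suc j"] j by simp
    qed
    have "is_atom (as ! j)" using at j nth_mem by blast
    then have "as ! j \<in> ?X j" using not_le ins by (auto simp: atoms_below_def)
    then have "\<forall>b\<in>?X j. w (as ! j) \<le> w b"
      using atom_min_eq_iff[of "?X j" "as ! j"] mn[OF j] by (auto simp: atoms_below_def)
    then show "is_atom (as ! j) \<and> \<not> as ! j \<le> sup bot (Sup (set (take j as))) \<and>
       (\<forall>b. is_atom b \<and> b \<le> sup bot (Sup (set (take (Suc j) as))) \<and> \<not> b \<le> sup bot (Sup (set (take j as)))
        \<longrightarrow> w (as ! j) \<le> w b)"
      using \<open>is_atom (as ! j)\<close> not_le by (auto simp: atoms_below_def)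
  qed
  ultimately show "min_labels w bot as \<and> Sup (set as) = u" by simp
next
  assume *: "min_labels w bot as \<and> Sup (set as) = u"
  then have at: "set as \<subseteq> {a. is_atom a}" using min_labels_atoms by blast
  have rk: "rk u = length as" using * min_labels_rk[of bot as] by (simp add: rk_bot)
  \<comment> \<open>The rank is the length of the word but at most the number of its distinct
    letters, so no letter repeats.\<close>
  have "rk u \<le> card (set as)" using rk_sup_atoms_le[OF at, of bot] * by (simp add: rk_bot)
  then have card: "card (set as) = length as" using rk card_length[of as] by simp
  have "nbc_independent w (set as)"
    unfolding nbc_independent_def
  proof (intro conjI allI impI at)
    show "rk (Sup (set as)) = card (set as)" using * rk card by simp
    fix b assume b: "is_atom b \<and> b \<notin> set as \<and> b \<le> Sup (set as)"
    then have "\<not> b \<le> bot" by (auto simp: is_atom_def covers_def bot_unique)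
    then obtain a where a: "a \<in> set as" "w a \<le> w b" using min_labels_exists_le[of w bot as b] * b by auto
    then have "w a \<noteq> w b" using inj_onD[OF inj_weight, of a b] at b by auto
    then show "\<exists>a\<in>set as. w a < w b" using a by (auto simp: less_le)
  qed
  moreover have "as ! j = atom_min w (atoms_below (Sup (set (take (Suc j) as))) - atoms_below (Sup (set (take j as))))"
    if j: "j < length as" for j
  proof (subst atom_min_eq_iff)
    show "as ! j \<in> atoms_below (Sup (set (take (Suc j) as))) - atoms_below (Sup (set (take j as)))"
      using * j unfolding min_labels_nth atoms_below_def by (auto simp: take_Suc_conv_app_nth)
    show "\<forall>b\<in>atoms_below (Sup (set (take (Suc j) as))) - atoms_below (Sup (set (take j as))). w (as ! j) \<le> w b"
      using * j unfolding min_labels_nth atoms_below_def by auto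
  qed (auto simp: atoms_below_def)
  ultimately show "nbc_plus_basis w u as"
    unfolding nbc_plus_basis_def
    using at * rk card by (auto simp: atoms_below_def card_distinct intro: Sup_upper)
qed

definition greedy_word :: "'a \<Rightarrow> 'a \<Rightarrow> 'a list" where
  "greedy_word z y = (SOME as. greedy w y z as)"

text \<open>For \<open>z \<le> y\<close> this is the minimum weight of a basis of \<open>y\<close>
  over \<open>z\<close>, by \<open>greedy_weight_le\<close>.\<close>

definition greedy_weight :: "'a \<Rightarrow> 'a \<Rightarrow> nat" where
  "greedy_weight z y = sum_list (map w (greedy_word z y))"

lemma greedy_greedy_word: "z \<le> y \<Longrightarrow> greedy w y z (greedy_word z y)"
  unfolding greedy_word_def using greedy_exists by (rule someI_ex)

lemma greedy_word_eqI: "greedy w y z as \<Longrightarrow> greedy_word z y = as"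
  unfolding greedy_word_def by (meson greedy_unique some_equality)

text \<open>The NBC+ condition makes each row a label word and standardness makes it increasing;
  together they make it greedy.\<close>

lemma greedy_rows:
  assumes "standard_filling w rs F" "nbc_plus_basis w u (reading_word rs F)" "r < length rs"
  shows "greedy w (Sup (rows_below rs F (Suc r))) (Sup (rows_below rs F r)) (row rs F r)"
proof (rule min_labels_sorted_greedy)
  show "min_labels w (Sup (rows_below rs F r)) (row rs F r)"
    using assms(2,3) min_labels_rows[of "length rs" rs w F]
    unfolding nbc_plus_basis_iff reading_word_rows by auto
  show "sorted_wrt (\<lambda>a b. w a < w b) (row rs F r)"
    using assms by (intro standard_filling_row_sorted)
qed (simp add: Sup_rows_below_Suc assms(3))

lemma greedy_weight_le_weight:
  assumes "set bs \<subseteq> {a. is_atom a}" "rk (sup z (Sup (set bs))) = rk z + length bs"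
  shows "greedy_weight z (sup z (Sup (set bs))) \<le> sum_list (map w bs)"
proof -
  have g: "greedy w (sup z (Sup (set bs))) z (greedy_word z (sup z (Sup (set bs))))"
    by (intro greedy_greedy_word) simp
  show ?thesis
    using greedy_weight_le[OF g assms order_refl] greedy_length[OF g] assms(2)
    by (simp add: greedy_weight_def)
qed

end

section \<open>Chains of standard fillings\<close>

lemma strict_sorted_eq_sorted_list_of_set:
  fixes S :: "nat set"
  assumes "sorted_wrt (<) xs" "set xs \<subseteq> S" "length xs = card S" "finite S"
  shows "xs = sorted_list_of_set S"
proof -
  have "distinct xs" using assms(1) by (simp add: strict_sorted_iff)
  then have "set xs = S" using assms by (intro card_subset_eq) (auto simp: distinct_card)
  then show ?thesis using assms(1) \<open>distinct xs\<close> by (metis sorted_list_of_set.idem_if_sorted_distinct strict_sorted_iff)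
qed

lemma map_upt_less:
  fixes f g :: "nat \<Rightarrow> 'b::linorder"
  assumes "r < n" "\<And>i. i < r \<Longrightarrow> f i = g i" "f r < g r"
  shows "map f [0..<n] < map g [0..<n]"
proof -
  have "take r (map f [0..<n]) = take r (map g [0..<n])"
    using assms by (intro nth_equalityI) auto
  then show ?thesis
    unfolding list_less_def lexord_take_index_conv using assms(1,3) by (intro disjI2 exI[of _ r]) auto
qed

section \<open>Levels and row lengths given by the rank set\<close>

locale rank_selection = weighted_geometric_lattice w
  for w :: "'a::finite_lattice_complete \<Rightarrow> nat" +
  fixes S :: "nat set"
  assumes S_nonempty: "S \<noteq> {}" and S_finite: "finite S" and S_pos: "0 \<notin> S"
begin

abbreviation "k \<equiv> card S"
abbreviation "rs \<equiv> row_lengths S"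

definition lev :: "nat \<Rightarrow> nat" where
  "lev j = (0 # sorted_list_of_set S) ! j"

lemma k_pos: "0 < k"
  using S_nonempty S_finite by (simp add: card_gt_0_iff)

lemma length_rs [simp]: "length rs = k"
  by (simp add: row_lengths_def Let_def)

lemma lev_0 [simp]: "lev 0 = 0"
  by (simp add: lev_def)

lemma lev_in_S: "0 < j \<Longrightarrow> j \<le> k \<Longrightarrow> lev j \<in> S"
  using nth_mem[of "j - 1" "sorted_list_of_set S"] S_finite by (cases j) (auto simp: lev_def)

lemma lev_strict_mono: "i < j \<Longrightarrow> j \<le> k \<Longrightarrow> lev i < lev j"
proof -
  assume ij: "i < j" "j \<le> k"
  have "sorted_wrt (<) (0 # sorted_list_of_set S)"
    using S_pos S_finite by (auto intro: gr0I)
  from sorted_wrt_nth_less[OF this ij(1)] ij(2) show ?thesis by (simp add: lev_def)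
qed

lemma lev_k: "lev k = Max S"
proof (rule Max_eqI[symmetric])
  fix s assume "s \<in> S"
  then obtain i where i: "i < k" "s = lev (Suc i)"
    using S_finite by (metis in_set_conv_nth length_sorted_list_of_set lev_def nth_Cons_Suc set_sorted_list_of_set)
  then show "s \<le> lev k" using lev_strict_mono[of "Suc i" k] by (cases "Suc i = k") auto
qed (use S_finite lev_in_S k_pos in auto)

lemma lev_in_S': "0 < j \<Longrightarrow> j < k \<Longrightarrow> lev j \<in> S - {Max S}"
  using lev_in_S[of j] lev_strict_mono[of j k] lev_k by auto

lemma rs_nth: "r < k \<Longrightarrow> rs ! r = lev (Suc r) - lev r"
  by (cases r) (auto simp: row_lengths_def Let_def lev_def)

lemma rs_pos: "r < length rs \<Longrightarrow> 1 \<le> rs ! r"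
  using lev_strict_mono[of r "Suc r"] by (simp add: rs_nth)

lemma sum_rs: "j \<le> k \<Longrightarrow> (\<Sum>r<j. rs ! r) = lev j"
proof (induction j)
  case (Suc j)
  then show ?case using lev_strict_mono[of j "Suc j"] by (simp add: rs_nth)
qed simp

text \<open>What survives a column permutation, which may destroy standardness and the NBC+
  condition: the entries still form a basis of \<open>u\<close>, as the ribbon has
  \<open>Max S\<close> cells.\<close>

definition basis_filling :: "'a \<Rightarrow> (nat \<times> nat \<Rightarrow> 'a) \<Rightarrow> bool" where
  "basis_filling u F \<longleftrightarrow> rk u = Max S \<and> inj_on F (rib rs) \<and> F ` rib rs \<subseteq> {a. is_atom a} \<and> Sup (F ` rib rs) = u"

definition standard_basis_filling :: "'a \<Rightarrow> (nat \<times> nat \<Rightarrow> 'a) \<Rightarrow> bool" where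
  "standard_basis_filling u F \<longleftrightarrow>
     rk u = Max S \<and> standard_filling w rs F \<and> nbc_plus_basis w u (reading_word rs F)"

abbreviation filling_chain :: "(nat \<times> nat \<Rightarrow> 'a) \<Rightarrow> 'a list" where
  "filling_chain F \<equiv> chain_of_tabloid k (tabloid rs F)"

abbreviation Q :: "'a \<Rightarrow> 'a set" where
  "Q u \<equiv> rank_sel_open (S - {Max S}) u"

text \<open>The end points \<open>bot\<close> and \<open>u\<close> are added to the chain, so that
  row \<open>r\<close> corresponds to the interval between nodes \<open>r\<close> and
  \<open>Suc r\<close>.\<close>

definition node :: "'a \<Rightarrow> 'a list \<Rightarrow> nat \<Rightarrow> 'a" where
  "node u xs j = (bot # xs @ [u]) ! j"

definition chain_weight :: "'a \<Rightarrow> 'a list \<Rightarrow> nat list" where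
  "chain_weight u xs = map (\<lambda>r. greedy_weight (node u xs r) (node u xs (Suc r))) [0..<k]"

lemma standard_basis_filling_basis: "standard_basis_filling u F \<Longrightarrow> basis_filling u F"
proof -
  assume std: "standard_basis_filling u F"
  then have nbc: "nbc_plus_basis w u (reading_word rs F)" by (simp add: standard_basis_filling_def)
  then have "inj_on F (rib rs)" by (intro inj_on_reading_word) (simp add: nbc_plus_basis_def)
  moreover have "F ` rib rs \<subseteq> {a. is_atom a}" "Sup (F ` rib rs) = u"
    using nbc min_labels_atoms[of w bot "reading_word rs F"]
    unfolding nbc_plus_basis_iff set_reading_word by auto
  ultimately show ?thesis using std by (simp add: basis_filling_def standard_basis_filling_def)
qed

lemma basis_filling_permute: "basis_filling u F \<Longrightarrow> \<pi> \<in> col_perms rs \<Longrightarrow> basis_filling u (F \<circ> \<pi>)"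
proof -
  assume bf: "basis_filling u F" and "\<pi> \<in> col_perms rs"
  then have "\<pi> permutes rib rs" by (simp add: col_perms_def)
  then have "inj_on \<pi> (rib rs)" "\<pi> ` rib rs = rib rs"
    by (auto simp: permutes_inj_on permutes_image)
  then show ?thesis
    using bf comp_inj_on[of \<pi> "rib rs" F] unfolding basis_filling_def image_comp[symmetric] by auto
qed

context
  fixes u F
  assumes bf: "basis_filling u F"
begin

text \<open>There are as many cells as the rank of \<open>u\<close>, so the entries are independent,
  and so are those in the rows below \<open>j\<close>.\<close>

lemma rk_Sup_rows_below:
  assumes "j \<le> k"
  shows "rk (Sup (rows_below rs F j)) = lev j"
proof -
  have inj: "inj_on F (rib rs)" using bf by (simp add: basis_filling_def)
  have ind: "rk (Sup (F ` rib rs)) = card (F ` rib rs)"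
    using bf card_image[OF inj] card_rib[of rs] sum_rs[of k] by (simp add: basis_filling_def lev_k)
  have "rk (Sup (rows_below rs F j)) = card (rows_below rs F j)"
    using bf assms by (intro rk_Sup_subset_independent[OF _ ind]) (auto simp: basis_filling_def rows_below_image)
  also have "\<dots> = card {x \<in> rib rs. snd x < j}"
    using assms inj by (simp add: rows_below_image) (intro card_image, auto intro: inj_on_subset)
  also have "\<dots> = lev j" using finite_card_rib_below[of j rs] assms sum_rs by simp
  finally show ?thesis .
qed

lemma node_filling_chain: "j \<le> k \<Longrightarrow> node u (filling_chain F) j = Sup (rows_below rs F j)"
  using bf k_pos rows_below_length[of rs F] unfolding node_def basis_filling_def
  by (cases j; cases "j = k") (auto simp: nth_append nth_chain_of_tabloid)

lemma filling_chain_simplex: "filling_chain F \<in> simplices (Q u) (k - 1)"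
proof -
  have u: "rk u = lev k" using bf by (simp add: basis_filling_def lev_k)
  have less: "Sup (rows_below rs F i) < Sup (rows_below rs F j)" if "i < j" "j \<le> k" for i j
  proof -
    have "Sup (rows_below rs F i) \<le> Sup (rows_below rs F j)"
      using that by (intro Sup_subset_mono) (force simp: rows_below_def)
    moreover have "Sup (rows_below rs F i) \<noteq> Sup (rows_below rs F j)"
      using rk_Sup_rows_below[of i] rk_Sup_rows_below[of j] lev_strict_mono[of i j] that by auto
    ultimately show ?thesis by simp
  qed
  have "Sup (rows_below rs F k) = u"
    using bf rows_below_length[of rs F] by (simp add: basis_filling_def)
  then have "Sup (rows_below rs F (Suc i)) \<in> Q u" if "i < k - 1" for i
    using less[of 0 "Suc i"] less[of "Suc i" k] that lev_in_S'[of "Suc i"] rk_Sup_rows_below[of "Suc i"]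
    by (auto simp: rank_sel_open_def)
  then have "set (filling_chain F) \<subseteq> Q u"
    by (auto simp: in_set_conv_nth nth_chain_of_tabloid)
  moreover have "sorted_wrt (<) (filling_chain F)"
    unfolding sorted_wrt_iff_nth_less using less by (auto simp: nth_chain_of_tabloid)
  ultimately show ?thesis by (simp add: simplices_def)
qed

lemma greedy_weight_row_le:
  assumes "r < k"
  shows "greedy_weight (Sup (rows_below rs F r)) (Sup (rows_below rs F (Suc r))) \<le> sum_list (map w (row rs F r))"
proof -
  have S: "Sup (rows_below rs F (Suc r)) = sup (Sup (rows_below rs F r)) (Sup (set (row rs F r)))"
    using assms by (intro Sup_rows_below_Suc) simp
  have at: "set (row rs F r) \<subseteq> {a. is_atom a}"
    using assms bf by (auto simp: set_row tabloid_def basis_filling_def)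
  show ?thesis
    unfolding S
  proof (rule greedy_weight_le_weight[OF at])
    show "rk (sup (Sup (rows_below rs F r)) (Sup (set (row rs F r)))) = rk (Sup (rows_below rs F r)) + length (row rs F r)"
      using rk_Sup_rows_below[of r] rk_Sup_rows_below[of "Suc r"] assms rs_nth[of r] lev_strict_mono[of r "Suc r"]
      by (simp flip: S)
  qed
qed

end

lemma chain_weight_standard_nth:
  assumes "standard_basis_filling u F" "r < k"
  shows "greedy_weight (Sup (rows_below rs F r)) (Sup (rows_below rs F (Suc r))) = sum_list (map w (row rs F r))"
proof -
  have "greedy w (Sup (rows_below rs F (Suc r))) (Sup (rows_below rs F r)) (row rs F r)"
    using assms by (intro greedy_rows) (auto simp: standard_basis_filling_def)
  from greedy_word_eqI[OF this] show ?thesis by (simp add: greedy_weight_def)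
qed

text \<open>Let \<open>r\<close> be the first changed row. The nodes up to \<open>r\<close> agree;
  at \<open>r\<close> the permuted chain weighs at most as much as its row, which is lighter than
  the original row, and the original row attains its greedy weight.\<close>

lemma chain_weight_col_perm_less:
  assumes std: "standard_basis_filling u F" and \<pi>: "\<pi> \<in> col_perms rs" "\<pi> \<noteq> id"
  shows "chain_weight u (filling_chain (F \<circ> \<pi>)) < chain_weight u (filling_chain F)"
proof -
  have sf: "standard_filling w rs F" using std by (simp add: standard_basis_filling_def)
  note bF = standard_basis_filling_basis[OF std]
  note b\<pi> = basis_filling_permute[OF bF \<pi>(1)]
  obtain r where r: "r < length rs" "\<And>x. x \<in> rib rs \<Longrightarrow> snd x < r \<Longrightarrow> \<pi> x = x"
    "sum_list (map w (row rs (F \<circ> \<pi>) r)) < sum_list (map w (row rs F r))"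
    using col_perm_first_moved_row[OF sf \<pi>] by blast
  have same: "rows_below rs (F \<circ> \<pi>) j = rows_below rs F j" if "j \<le> r" for j
    using r(1,2) that by (auto simp: rows_below_image intro!: image_cong)
  have "greedy_weight (Sup (rows_below rs (F \<circ> \<pi>) r)) (Sup (rows_below rs (F \<circ> \<pi>) (Suc r)))
      \<le> sum_list (map w (row rs (F \<circ> \<pi>) r))"
    using r(1) by (intro greedy_weight_row_le[OF b\<pi>]) simp
  also note r(3)
  also have "sum_list (map w (row rs F r)) =
      greedy_weight (Sup (rows_below rs F r)) (Sup (rows_below rs F (Suc r)))"
    using chain_weight_standard_nth[OF std, of r] r(1) by simp
  finally have less: "greedy_weight (Sup (rows_below rs (F \<circ> \<pi>) r)) (Sup (rows_below rs (F \<circ> \<pi>) (Suc r)))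
      < greedy_weight (Sup (rows_below rs F r)) (Sup (rows_below rs F (Suc r)))" .
  show ?thesis
    unfolding chain_weight_def
    using r(1) same less node_filling_chain[OF bF] node_filling_chain[OF b\<pi>]
    by (intro map_upt_less[of r]) auto
qed

text \<open>Each row is the unique greedy word between two consecutive nodes, so the chain
  determines the filling on the ribbon.\<close>

lemma standard_basis_filling_eqI:
  assumes F: "standard_basis_filling u F" and G: "standard_basis_filling u G"
    and eq: "filling_chain F = filling_chain G" and x: "x \<in> rib rs"
  shows "F x = G x"
proof -
  obtain c r where cr: "x = (c, r)" by fastforce
  have r: "r < k" "rstart rs r \<le> c" "c < rstart rs r + rs ! r" using x cr by (auto simp: rib_def)
  have nodes: "Sup (rows_below rs F j) = Sup (rows_below rs G j)" if "j \<le> k" for j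
    using node_filling_chain[OF standard_basis_filling_basis, OF F that]
      node_filling_chain[OF standard_basis_filling_basis, OF G that] eq by simp
  have "greedy w (Sup (rows_below rs F (Suc r))) (Sup (rows_below rs F r)) (row rs F r)"
    "greedy w (Sup (rows_below rs G (Suc r))) (Sup (rows_below rs G r)) (row rs G r)"
    using F G r(1) by (auto intro!: greedy_rows simp: standard_basis_filling_def)
  then have "row rs F r = row rs G r" using nodes[of r] nodes[of "Suc r"] r(1) greedy_unique by auto
  then show ?thesis using row_nth[of rs r c F] row_nth[of rs r c G] r cr by simp
qed

text \<open>All other column permutations give strictly lighter chains, so only the identity
  contributes.\<close>

lemma f_chain_lead:
  assumes std: "standard_basis_filling u F"
  shows "f_chain k (v_F rs F) (filling_chain F) = 1"
proof -
  have "id \<in> col_perms rs" by (simp add: col_perms_def permutes_id)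
  have "(filling_chain (F \<circ> \<pi>) = filling_chain F) \<longleftrightarrow> \<pi> = id" if "\<pi> \<in> col_perms rs" for \<pi>
    using chain_weight_col_perm_less[OF std that] by (cases "\<pi> = id") auto
  then have "f_chain k (v_F rs F) (filling_chain F) = (\<Sum>\<pi>\<in>col_perms rs. if \<pi> = id then 1 else 0)"
    unfolding f_chain_v_F by (intro sum.cong refl) auto
  then show ?thesis using finite_col_perms[of rs] \<open>id \<in> col_perms rs\<close> by simp
qed

lemma f_chain_less:
  assumes std: "standard_basis_filling u F" and nz: "f_chain k (v_F rs F) xs \<noteq> 0" "filling_chain F \<noteq> xs"
  shows "chain_weight u xs < chain_weight u (filling_chain F)"
proof -
  obtain \<pi> where \<pi>: "\<pi> \<in> col_perms rs" "filling_chain (F \<circ> \<pi>) = xs"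
    using f_chain_v_F_nonzeroD[OF nz(1)] by blast
  then have "\<pi> \<noteq> id" using nz(2) by auto
  with chain_weight_col_perm_less[OF std \<pi>(1)] \<pi>(2) show ?thesis by simp
qed

lemma f_chain_cycle:
  assumes bf: "basis_filling u F"
  shows "f_chain k (v_F rs F) \<in> cycles (Q u) (k - 1)"
proof -
  have simplex: "filling_chain (F \<circ> \<pi>) \<in> simplices (Q u) (k - 1)" if "\<pi> \<in> col_perms rs" for \<pi>
    using filling_chain_simplex[OF basis_filling_permute[OF bf that]] .
  have "xs \<in> simplices (Q u) (k - 1)" if nz: "f_chain k (v_F rs F) xs \<noteq> 0" for xs
  proof -
    obtain \<pi> where "\<pi> \<in> col_perms rs" "filling_chain (F \<circ> \<pi>) = xs"
      using f_chain_v_F_nonzeroD[OF nz] by blast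
    then show ?thesis using simplex by auto
  qed
  moreover have "boundary (Q u) (k - 1) (f_chain k (v_F rs F)) = (\<lambda>_. 0)"
    using boundary_f_chain_v_F[of rs F "Q u"] rs_pos simplex by simp
  ultimately show ?thesis by (auto simp: cycles_def chain_on_def)
qed

section \<open>Heaviest chains of cycles\<close>

text \<open>The \<open>k - 1\<close> distinct ranks below \<open>Max S\<close>, together with the
  rank of \<open>u\<close>, leave out no element of \<open>S\<close>: a simplex has exactly one
  vertex of each selected rank.\<close>

lemma map_rk_simplex:
  assumes "rk u = Max S" "xs \<in> simplices (Q u) (k - 1)"
  shows "map rk (xs @ [u]) = sorted_list_of_set S"
proof (rule strict_sorted_eq_sorted_list_of_set)
  have xs: "length xs = k - 1" "sorted_wrt (<) xs" "\<And>x. x \<in> set xs \<Longrightarrow> x < u \<and> rk x \<in> S"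
    using assms(2) by (auto simp: simplices_def rank_sel_open_def)
  have "sorted_wrt (<) (xs @ [u])" using xs by (auto simp: sorted_wrt_append)
  then show "sorted_wrt (<) (map rk (xs @ [u]))"
    unfolding sorted_wrt_map by (rule sorted_wrt_mono_rel[rotated]) (rule rk_strict_mono)
  show "set (map rk (xs @ [u])) \<subseteq> S" using xs assms(1) S_finite S_nonempty by auto
  show "length (map rk (xs @ [u])) = card S" using xs k_pos by simp
qed (rule S_finite)

section \<open>The filling attached to a chain\<close>

context
  fixes u xs
  assumes u: "rk u = Max S" and xs: "xs \<in> simplices (Q u) (k - 1)"
begin

lemma length_simplex: "length xs = k - 1"
  using xs by (simp add: simplices_def)

lemma node_0: "node u xs 0 = bot"
  by (simp add: node_def)

lemma node_k: "node u xs k = u"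
  using length_simplex k_pos by (cases k) (auto simp: node_def nth_append)

lemma node_Suc: "i < k - 1 \<Longrightarrow> node u xs (Suc i) = xs ! i"
  using length_simplex by (simp add: node_def nth_append)

lemma rk_node: "j \<le> k \<Longrightarrow> rk (node u xs j) = lev j"
proof (cases j)
  case (Suc i)
  assume "j \<le> k"
  then have "rk (node u xs j) = map rk (xs @ [u]) ! i"
    using Suc length_simplex by (subst nth_map) (auto simp: node_def)
  then show ?thesis using map_rk_simplex[OF u xs] Suc by (simp add: lev_def)
qed (simp add: node_0 rk_bot)

lemma node_le: "r < k \<Longrightarrow> node u xs r \<le> node u xs (Suc r)"
proof -
  assume r: "r < k"
  have "sorted_wrt (<) (xs @ [u])" "\<forall>x\<in>set xs. bot < x"
    using xs by (auto simp: simplices_def rank_sel_open_def sorted_wrt_append)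
  then have "sorted_wrt (\<le>) (bot # xs @ [u])"
    using sorted_wrt_mono_rel[of "xs @ [u]" "(<)" "(\<le>)"] by (simp add: less_imp_le)
  from sorted_wrt_nth_less[OF this, of r "Suc r"] show ?thesis
    using r length_simplex by (simp add: node_def)
qed

lemma greedy_node: "r < k \<Longrightarrow> greedy w (node u xs (Suc r)) (node u xs r) (greedy_word (node u xs r) (node u xs (Suc r)))"
  using greedy_greedy_word node_le by blast

lemma length_greedy_node: "r < k \<Longrightarrow> length (greedy_word (node u xs r) (node u xs (Suc r))) = rs ! r"
  using greedy_length[OF greedy_node, of r] rk_node[of r] rk_node[of "Suc r"] by (simp add: rs_nth)

text \<open>The candidate filling with leading chain \<open>xs\<close>: its rows are the greedy
  words between consecutive nodes. Values off the ribbon carry no meaning.\<close>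

definition chain_filling :: "nat \<times> nat \<Rightarrow> 'a" where
  "chain_filling = (\<lambda>(c, r). greedy_word (node u xs r) (node u xs (Suc r)) ! (c - rstart rs r))"

lemma row_chain_filling: "r < k \<Longrightarrow> row rs chain_filling r = greedy_word (node u xs r) (node u xs (Suc r))"
  using length_greedy_node[of r] by (intro nth_equalityI) (auto simp: row_def chain_filling_def)

lemma Sup_rows_below_chain_filling: "j \<le> k \<Longrightarrow> Sup (rows_below rs chain_filling j) = node u xs j"
proof (induction j)
  case (Suc j)
  then show ?case
    using greedy_Sup[OF greedy_node, of j] by (simp add: Sup_rows_below_Suc row_chain_filling)
qed (simp add: node_0)

lemma filling_chain_chain_filling: "filling_chain chain_filling = xs"
  using length_simplex
  by (intro nth_equalityI) (auto simp: nth_chain_of_tabloid Sup_rows_below_chain_filling node_Suc)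

text \<open>Greedy words concatenate to a label word for every chain; only standardness will depend
  on the chain being heaviest in a cycle.\<close>

lemma nbc_plus_basis_chain_filling: "nbc_plus_basis w u (reading_word rs chain_filling)"
proof -
  have "min_labels w bot (reading_word rs chain_filling)"
    unfolding reading_word_rows using min_labels_rows[of "length rs" rs w chain_filling]
      greedy_min_labels[OF greedy_node]
    by (simp add: row_chain_filling Sup_rows_below_chain_filling)
  moreover have "Sup (set (reading_word rs chain_filling)) = u"
    using Sup_rows_below_chain_filling[of k] rows_below_length[of rs chain_filling]
    by (simp add: set_reading_word node_k)
  ultimately show ?thesis by (simp add: nbc_plus_basis_iff)
qed

end

text \<open>A face remembers the rank of the deleted vertex: if \<open>i\<close> differed from
  \<open>r\<close>, the face would still contain a vertex of rank \<open>lev (Suc r)\<close>, which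
  it lacks as a face of \<open>xs\<close>.\<close>

lemma remove_nth_simplex_index:
  assumes u: "rk u = Max S" and xs: "xs \<in> simplices (Q u) (k - 1)" "xs' \<in> simplices (Q u) (k - 1)"
    and r: "r < k - 1" and i: "i < k - 1"
    and eq: "take i xs' @ drop (Suc i) xs' = take r xs @ drop (Suc r) xs"
  shows "i = r"
proof (rule ccontr)
  assume "i \<noteq> r"
  have len: "length xs = k - 1" "length xs' = k - 1" using xs by (auto simp: simplices_def)
  have rk_eq: "rk (ys ! j) = lev (Suc j)" if "ys \<in> simplices (Q u) (k - 1)" "j < k - 1" for ys j
    using rk_node[OF u that(1), of "Suc j"] node_Suc[OF u that(1), of j] that(2) by simp
  have "xs' ! r \<in> set (take i xs' @ drop (Suc i) xs')"
  proof (cases "r < i")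
    case True
    then have "xs' ! r = take i xs' ! r" "r < length (take i xs')" using len i by auto
    then show ?thesis by (metis UnI1 nth_mem set_append)
  next
    case False
    then have "xs' ! r = drop (Suc i) xs' ! (r - Suc i)" "r - Suc i < length (drop (Suc i) xs')"
      using len r \<open>i \<noteq> r\<close> by auto
    then show ?thesis by (metis UnI2 nth_mem set_append)
  qed
  then have "xs' ! r \<in> set (take r xs) \<or> xs' ! r \<in> set (drop (Suc r) xs)" unfolding eq by simp
  then obtain j where j: "j < k - 1" "j \<noteq> r" "xs' ! r = xs ! j"
  proof
    assume "xs' ! r \<in> set (take r xs)"
    then obtain j where "j < r" "xs' ! r = xs ! j" using len r by (auto simp: in_set_conv_nth)
    then show thesis using that[of j] r by auto
  next
    assume "xs' ! r \<in> set (drop (Suc r) xs)"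
    then obtain j where "j < k - 1 - Suc r" "xs' ! r = drop (Suc r) xs ! j"
      using len by (metis in_set_conv_nth length_drop)
    then show thesis using that[of "Suc r + j"] len r by auto
  qed
  then have "lev (Suc r) = lev (Suc j)" using rk_eq[OF xs(1) j(1)] rk_eq[OF xs(2) r] by simp
  moreover have "Suc r \<le> k" "Suc j \<le> k" using r j(1) by auto
  ultimately show False
    using lev_strict_mono[of "Suc r" "Suc j"] lev_strict_mono[of "Suc j" "Suc r"] j(2)
    by (cases "r < j") auto
qed

text \<open>If the concatenation of two consecutive words is increasing, it is a greedy word itself, so
  that its first part is strictly lighter than the word of any other intermediate element.\<close>
lemma chain_weight_ascent_less:
  assumes u: "rk u = Max S" and xs: "xs \<in> simplices (Q u) (k - 1)" and r: "Suc r < k"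
    and asc: "w (last (greedy_word (node u xs r) (node u xs (Suc r))))
      \<le> w (hd (greedy_word (node u xs (Suc r)) (node u xs (Suc (Suc r)))))"
    and xs': "xs' \<in> simplices (Q u) (k - 1)" "xs' \<noteq> xs"
    and eq: "take r xs' @ drop (Suc r) xs' = take r xs @ drop (Suc r) xs"
  shows "chain_weight u xs < chain_weight u xs'"
proof -
  define z y y2 y' where "z = node u xs r" and "y = node u xs (Suc r)"
    and "y2 = node u xs (Suc (Suc r))" and "y' = node u xs' (Suc r)"
  define \<alpha> \<beta> \<gamma> where "\<alpha> = greedy_word z y" and "\<beta> = greedy_word y y2" and "\<gamma> = greedy_word z y'"
  have len: "length xs = k - 1" "length xs' = k - 1" using xs xs' by (auto simp: simplices_def)
  have "length (take r xs') = length (take r xs)" using len by simp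
  then have parts: "take r xs' = take r xs" "drop (Suc r) xs' = drop (Suc r) xs"
    using eq by (auto simp: append_eq_append_conv)
  have nth_eq: "xs' ! i = xs ! i" if "i \<noteq> r" "i < k - 1" for i
  proof (cases "i < r")
    case True
    then show ?thesis using parts(1) by (metis nth_take)
  next
    case False
    then have "xs ! i = drop (Suc r) xs ! (i - Suc r)" "xs' ! i = drop (Suc r) xs' ! (i - Suc r)"
      using that len by auto
    then show ?thesis using parts(2) by simp
  qed
  have nodes: "node u xs' j = node u xs j" if "j \<noteq> Suc r" "j \<le> k" for j
  proof -
    show ?thesis
    proof (cases "j = 0 \<or> j = k")
      case True
      then show ?thesis
        using node_k[OF u xs] node_k[OF u xs'(1)] node_0[OF u xs] node_0[OF u xs'(1)] by auto
    next
      case False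
      then obtain i where "j = Suc i" "i < k - 1" using \<open>j \<le> k\<close> by (cases j) auto
      then show ?thesis
        using node_Suc[OF u xs, of i] node_Suc[OF u xs'(1), of i] nth_eq[of i] that(1) by simp
    qed
  qed
  have rk': "r < k" using r by simp
  have "node u xs' r = z" "node u xs' (Suc (Suc r)) = y2"
    unfolding z_def y2_def using r by (intro nodes; simp)+
  have g\<alpha>: "greedy w y z \<alpha>" unfolding y_def z_def \<alpha>_def by (rule greedy_node[OF u xs rk'])
  have g\<beta>: "greedy w y2 y \<beta>" unfolding y_def y2_def \<beta>_def by (rule greedy_node[OF u xs r])
  have g\<gamma>: "greedy w y' z \<gamma>"
    using greedy_node[OF u xs'(1) rk'] unfolding \<open>node u xs' r = z\<close> \<gamma>_def y'_def .
  have "y' \<le> y2"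
    using node_le[OF u xs'(1) r] unfolding \<open>node u xs' (Suc (Suc r)) = y2\<close> y'_def .
  have rk: "rk z = lev r" "rk y = lev (Suc r)" "rk y' = lev (Suc r)" "rk y2 = lev (Suc (Suc r))"
    unfolding z_def y_def y'_def y2_def using r by (auto intro!: rk_node[OF u xs] rk_node[OF u xs'(1)])
  have lens: "length \<gamma> = length \<alpha>"
    using greedy_length[OF g\<alpha>] greedy_length[OF g\<gamma>] rk by simp
  have ne: "\<alpha> \<noteq> []" "\<beta> \<noteq> []"
    using greedy_length[OF g\<alpha>] greedy_length[OF g\<beta>] rk lev_strict_mono[of r "Suc r"]
      lev_strict_mono[of "Suc r" "Suc (Suc r)"] r by auto
  \<comment> \<open>\<open>asc\<close> is only a weak inequality; it is strict because
    \<open>last \<alpha>\<close> lies below \<open>y\<close> and \<open>hd \<beta>\<close> does not,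
    so these atoms differ.\<close>
  have "w (last \<alpha>) < w (hd \<beta>)"
  proof -
    have "last \<alpha> \<in> set \<alpha>" using ne by simp
    then have "last \<alpha> \<le> Sup (set \<alpha>)" by (rule Sup_upper)
    also have "\<dots> \<le> y" using greedy_Sup[OF g\<alpha>] sup_ge2 by metis
    finally have "last \<alpha> \<le> y" .
    moreover have "\<not> hd \<beta> \<le> y" using g\<beta> ne by (cases \<beta>) auto
    ultimately have "last \<alpha> \<noteq> hd \<beta>" by auto
    moreover have "is_atom (last \<alpha>)" "is_atom (hd \<beta>)"
      using greedy_atoms[OF g\<alpha>] greedy_atoms[OF g\<beta>] ne last_in_set hd_in_set by blast+
    ultimately have "w (last \<alpha>) \<noteq> w (hd \<beta>)" using inj_onD[OF inj_weight] by auto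
    then show ?thesis using asc unfolding \<alpha>_def \<beta>_def z_def y_def y2_def by simp
  qed
  moreover have "transp (\<lambda>a b. w a < w b)" by (auto intro: transpI)
  note sorted_conv = successively_conv_sorted_wrt[OF this, symmetric]
  ultimately have "sorted_wrt (\<lambda>a b. w a < w b) (\<alpha> @ \<beta>)"
    using greedy_sorted[OF g\<alpha>] greedy_sorted[OF g\<beta>]
    unfolding sorted_conv successively_append_iff by blast
  moreover have "min_labels w z (\<alpha> @ \<beta>)"
    unfolding min_labels_append greedy_Sup[OF g\<alpha>]
    using greedy_min_labels[OF g\<alpha>] greedy_min_labels[OF g\<beta>] by blast
  moreover have "sup z (Sup (set (\<alpha> @ \<beta>))) = y2"
    unfolding set_append Sup_union_distrib sup_assoc[symmetric] greedy_Sup[OF g\<alpha>] greedy_Sup[OF g\<beta>] ..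
  \<comment> \<open>An increasing label word is greedy, here for the two-step interval from
    \<open>z\<close> to \<open>y2\<close>. Its prefix \<alpha> therefore weighs at most as much as
    \<gamma>, an independent word of the same length in that interval.\<close>
  ultimately have g: "greedy w y2 z (\<alpha> @ \<beta>)" by (intro min_labels_sorted_greedy)
  note \<gamma> = greedy_atoms[OF g\<gamma>] greedy_Sup[OF g\<gamma>] greedy_length[OF g\<gamma>]
  have "sum_list (map w \<alpha>) \<le> sum_list (map w \<gamma>)"
    using greedy_weight_le[OF g \<gamma>(1)] \<gamma>(2,3) \<open>y' \<le> y2\<close> lens by simp
  \<comment> \<open>Equal weights would force equal sets of atoms, hence \<open>y = y'\<close> and
    equal chains.\<close>
  moreover have "sum_list (map w \<alpha>) \<noteq> sum_list (map w \<gamma>)"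
  proof
    assume "sum_list (map w \<alpha>) = sum_list (map w \<gamma>)"
    then have "set \<alpha> = set \<gamma>"
      using greedy_weight_eqD[OF g \<gamma>(1)] \<gamma>(2,3) \<open>y' \<le> y2\<close> lens by simp
    then have "y = y'" using greedy_Sup[OF g\<alpha>] \<gamma>(2) by simp
    then have "xs' ! r = xs ! r" using node_Suc[OF u xs, of r] node_Suc[OF u xs'(1), of r] r
      unfolding y_def y'_def by simp
    then have "xs' ! i = xs ! i" if "i < k - 1" for i using nth_eq that by (cases "i = r") auto
    then have "xs' = xs" using len by (intro nth_equalityI) auto
    with xs'(2) show False ..
  qed
  ultimately have less: "greedy_weight z y < greedy_weight z y'"
    unfolding greedy_weight_def \<alpha>_def \<gamma>_def by simp
  show ?thesis
    unfolding chain_weight_def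
  proof (rule map_upt_less[OF rk'])
    show "greedy_weight (node u xs i) (node u xs (Suc i)) = greedy_weight (node u xs' i) (node u xs' (Suc i))"
      if "i < r" for i
      using that r nodes[of i] nodes[of "Suc i"] by simp
    show "greedy_weight (node u xs r) (node u xs (Suc r)) < greedy_weight (node u xs' r) (node u xs' (Suc r))"
      using less unfolding \<open>node u xs' r = z\<close> unfolding z_def y_def y'_def .
  qed
qed

lemma chain_filling_standard:
  assumes u: "rk u = Max S" and C: "C \<in> cycles (Q u) (k - 1)" and nz: "C xs \<noteq> 0"
    and max: "\<And>ys. C ys \<noteq> 0 \<Longrightarrow> chain_weight u ys \<le> chain_weight u xs"
  shows "standard_filling w rs (chain_filling u xs)"
proof -
  have xs: "xs \<in> simplices (Q u) (k - 1)" using C nz by (auto simp: cycles_def chain_on_def)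
  show ?thesis
  proof (rule standard_fillingI[OF rs_pos])
    fix r assume "r < length rs"
    then show "sorted_wrt (\<lambda>a b. w a < w b) (row rs (chain_filling u xs) r)"
      using greedy_sorted[OF greedy_node[OF u xs]] by (simp add: row_chain_filling[OF u xs])
  next
    fix r assume r: "Suc r < length rs"
    show "w (hd (row rs (chain_filling u xs) (Suc r))) < w (last (row rs (chain_filling u xs) r))"
    proof (rule ccontr)
      assume "\<not> ?thesis"
      then have asc: "w (last (greedy_word (node u xs r) (node u xs (Suc r))))
        \<le> w (hd (greedy_word (node u xs (Suc r)) (node u xs (Suc (Suc r)))))"
        using r by (simp add: row_chain_filling[OF u xs])
      let ?ys = "take r xs @ drop (Suc r) xs"
      let ?D = "\<lambda>xs'. \<Sum>i<k - 1. if take i xs' @ drop (Suc i) xs' = ?ys then (-1) ^ i else (0::complex)"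
      \<comment> \<open>A chain that shares this face by deletion at \<open>r\<close> is strictly
        heavier than \<open>xs\<close>, hence outside the support of \<open>C\<close>; deletion at
        any other position cannot produce the face.\<close>
      have zero: "C xs' * ?D xs' = 0" if xs': "xs' \<in> simplices (Q u) (k - 1) - {xs}" for xs'
      proof (cases "take r xs' @ drop (Suc r) xs' = ?ys")
        case True
        then have "chain_weight u xs < chain_weight u xs'"
          using chain_weight_ascent_less[OF u xs _ asc, of xs'] r xs' by simp
        then have "C xs' = 0" using max[of xs'] by (meson leD)
        then show ?thesis by simp
      next
        case False
        then have "?D xs' = 0"
        proof (intro sum.neutral ballI)
          fix i assume "i \<in> {..<k - 1}"
          then have "take i xs' @ drop (Suc i) xs' \<noteq> ?ys"
            using remove_nth_simplex_index[OF u xs, of xs' r i] xs' r False by auto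
          then show "(if take i xs' @ drop (Suc i) xs' = ?ys then (-1) ^ i else (0::complex)) = 0" by simp
        qed
        then show ?thesis by simp
      qed
      have "?D xs = (\<Sum>i<k - 1. if i = r then (-1) ^ i else 0)"
        using remove_nth_simplex_index[OF u xs xs, of r] r by (intro sum.cong refl) auto
      also have "\<dots> = (-1) ^ r" using r by simp
      finally have D: "?D xs = (-1) ^ r" .
      \<comment> \<open>The coefficient of the face in the boundary of \<open>C\<close> reduces to
        \<open>C xs\<close> up to sign, which is not zero.\<close>
      have "0 = boundary (Q u) (k - 1) C ?ys" using C by (simp add: cycles_def)
      also have "\<dots> = C xs * ?D xs + (\<Sum>xs'\<in>simplices (Q u) (k - 1) - {xs}. C xs' * ?D xs')"
        unfolding boundary_def by (rule sum.remove[OF finite_simplices xs])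
      also have "(\<Sum>xs'\<in>simplices (Q u) (k - 1) - {xs}. C xs' * ?D xs') = 0"
        using zero by (rule sum.neutral[rule_format])
      finally show False using nz D by simp
    qed
  qed
qed

lemma exists_standard_basis_filling:
  assumes u: "rk u = Max S" and C: "C \<in> cycles (Q u) (k - 1)" "C xs \<noteq> 0"
    and max: "\<And>ys. C ys \<noteq> 0 \<Longrightarrow> chain_weight u ys \<le> chain_weight u xs"
  shows "\<exists>F. standard_basis_filling u F \<and> filling_chain F = xs"
proof -
  have xs: "xs \<in> simplices (Q u) (k - 1)" using C by (auto simp: cycles_def chain_on_def)
  show ?thesis
    using chain_filling_standard[OF u C max] nbc_plus_basis_chain_filling[OF u xs]
      filling_chain_chain_filling[OF u xs] u
    unfolding standard_basis_filling_def by blast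
qed

section \<open>Vanishing of boundaries and the basis of homology\<close>

lemma simplices_k_empty: "simplices (Q u) k = {}"
proof -
  \<comment> \<open>A chain of \<open>k\<close> elements would need \<open>k\<close> distinct ranks
    in \<open>S - {Max S}\<close>, which has only \<open>k - 1\<close>.\<close>
  have False if xs: "xs \<in> simplices (Q u) k" for xs
  proof -
    have "sorted_wrt (<) (map rk xs)"
      using xs unfolding sorted_wrt_map simplices_def
      by (auto intro: sorted_wrt_mono_rel[rotated] rk_strict_mono)
    then have "card (set (map rk xs)) = k"
      using xs by (metis (mono_tags, lifting) distinct_card length_map mem_Collect_eq simplices_def strict_sorted_iff)
    moreover have "set (map rk xs) \<subseteq> S - {Max S}" using xs by (auto simp: simplices_def rank_sel_open_def)
    ultimately have "k \<le> card (S - {Max S})" using S_finite by (metis card_mono finite_Diff)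
    then show False using S_finite S_nonempty k_pos by simp
  qed
  then show ?thesis by blast
qed

lemma boundaries_trivial: "boundaries (Q u) (k - 1) = {\<lambda>_. 0}"
  using k_pos simplices_k_empty[of u]
  by (auto simp: boundaries_def boundary_def chain_on_def image_iff intro!: exI[of _ "\<lambda>_. 0"])

lemma WH_boundaries_trivial: "WH_boundaries S = {\<lambda>_. (\<lambda>_ :: 'a list. 0)}"
  unfolding WH_boundaries_def boundaries_trivial by (auto simp: fun_eq_iff)

lemma WH_cycles_iff:
  "C \<in> WH_cycles S \<longleftrightarrow> (\<forall>u. if rk u = Max S then C u \<in> cycles (Q u) (k - 1) else C u = (\<lambda>_. 0))"
  by (auto simp: WH_cycles_def)

theorem standard_fillings_homology_basis:
  "homology_basis (WH_cycles S) (WH_boundaries S)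
     ((\<lambda>(u, F). in_summand u (f_chain k (v_F rs F))) ` {(u, F). standard_basis_filling u F})"
\<comment> \<open>A position pairs a summand with a chain; the lists of length \<open>k - 1\<close>
  give a finite set of positions containing every support.\<close>
proof (rule homology_basis_triangular[where lead = "\<lambda>(u, F). (u, filling_chain F)" and W = chain_weight
      and X = "(UNIV :: 'a set) \<times> {xs. length xs = k - 1}"])
  show "finite ((UNIV :: 'a set) \<times> {xs :: 'a list. length xs = k - 1})"
    using finite_lists_length_eq[of "UNIV :: 'a set" "k - 1"] by simp
  show "WH_boundaries S = {\<lambda>_. (\<lambda>_ :: 'a list. 0)}" by (rule WH_boundaries_trivial)
next
  fix z :: "'a \<Rightarrow> 'a list \<Rightarrow> complex" and u x
  assume z: "z \<in> WH_cycles S" and nz: "z u x \<noteq> 0"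
  then have u: "rk u = Max S" and c: "z u \<in> cycles (Q u) (k - 1)"
    unfolding WH_cycles_iff by (auto split: if_splits)
  then show "(u, x) \<in> UNIV \<times> {xs. length xs = k - 1}"
    using nz by (auto simp: cycles_def chain_on_def simplices_def)
  show "\<exists>i\<in>{(u, F). standard_basis_filling u F}. (case i of (u, F) \<Rightarrow> (u, filling_chain F)) = (u, x)"
    if "\<And>y. z u y \<noteq> 0 \<Longrightarrow> chain_weight u y \<le> chain_weight u x"
    using exists_standard_basis_filling[OF u c nz that] by auto
next
  fix i assume "i \<in> {(u, F). standard_basis_filling u F}"
  then obtain u F where i: "i = (u, F)" and std: "standard_basis_filling u F" by auto
  have u: "rk u = Max S" using std by (simp add: standard_basis_filling_def)
  note cyc = f_chain_cycle[OF standard_basis_filling_basis[OF std]]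
  show mem: "(case i of (u, F) \<Rightarrow> in_summand u (f_chain k (v_F rs F))) \<in> WH_cycles S"
    unfolding WH_cycles_iff i using u cyc by (auto simp: in_summand_def zero_in_cycles)
  show "(\<lambda>v x. z v x - g * (case i of (u, F) \<Rightarrow> in_summand u (f_chain k (v_F rs F))) v x) \<in> WH_cycles S"
    if "z \<in> WH_cycles S" for z g
    using that mem unfolding WH_cycles_iff by (auto simp: cycles_diff split: if_splits)
  show "(case i of (u, F) \<Rightarrow> in_summand u (f_chain k (v_F rs F))) v x = 1"
    if "(case i of (u, F) \<Rightarrow> (u, filling_chain F)) = (v, x)" for v x
    using that f_chain_lead[OF std] by (auto simp: i in_summand_def)
  show "chain_weight v x < case_prod chain_weight (case i of (u, F) \<Rightarrow> (u, filling_chain F))"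
    if "(case i of (u, F) \<Rightarrow> in_summand u (f_chain k (v_F rs F))) v x \<noteq> 0"
      "(case i of (u, F) \<Rightarrow> (u, filling_chain F)) \<noteq> (v, x)" for v x
    using that f_chain_less[OF std, of x] by (auto simp: i in_summand_def split: if_splits)
next
  fix i j assume "i \<in> {(u, F). standard_basis_filling u F}" "j \<in> {(u, F). standard_basis_filling u F}"
    and eq: "(case i of (u, F) \<Rightarrow> (u, filling_chain F)) = (case j of (u, F) \<Rightarrow> (u, filling_chain F))"
  then obtain u F G where i: "i = (u, F)" "j = (u, G)"
    and std: "standard_basis_filling u F" "standard_basis_filling u G"
    and chains: "filling_chain F = filling_chain G" by auto
  \<comment> \<open>Fillings with the same chain agree on the ribbon and hence give the same cycle,
    even if they differ elsewhere.\<close>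
  show "(case i of (u, F) \<Rightarrow> in_summand u (f_chain k (v_F rs F))) =
      (case j of (u, F) \<Rightarrow> in_summand u (f_chain k (v_F rs F)))"
    unfolding i using v_F_cong[of rs F G] standard_basis_filling_eqI[OF std chains] by simp
qed

end

theorem theorem5p30:
  fixes w :: "'a::finite_lattice_complete \<Rightarrow> nat"
    and S :: "nat set"
  assumes "geometric_lattice TYPE('a)"
    and "inj_on w {a::'a. is_atom a}"
    and "S \<noteq> {}"
    and "S \<subseteq> {1..<rk (top::'a)}"
  shows "homology_basis (WH_cycles S) (WH_boundaries S)
           (\<Union>u\<in>{u::'a. rk u = Max S}.
              in_summand u ` {f_chain (card S) (v_F (row_lengths S) F) | F.
                 standard_filling w (row_lengths S) F \<and>
                 nbc_plus_basis w u (reading_word (row_lengths S) F)})"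
proof -
  \<comment> \<open>Inclusion in \<open>{1..<rk top}\<close> makes \<open>S\<close> finite and keeps
    0 out of it.\<close>
  interpret rank_selection w S
    using assms finite_subset[OF assms(4)] by unfold_locales auto
  \<comment> \<open>The union over \<open>u\<close> becomes one family indexed by pairs
    \<open>(u, F)\<close>, the form required by the triangular argument.\<close>
  have "(\<Union>u\<in>{u::'a. rk u = Max S}. in_summand u ` {f_chain k (v_F rs F) | F.
      standard_filling w rs F \<and> nbc_plus_basis w u (reading_word rs F)}) =
    (\<lambda>(u, F). in_summand u (f_chain k (v_F rs F))) ` {(u, F). standard_basis_filling u F}"
    by (auto simp: standard_basis_filling_def image_iff)
  then show ?thesis using standard_fillings_homology_basis by simp
qed

end
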